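(* Let $(\Omega,M)$ be a finite transformation monoid and $K$ a field of characteristic zero. Let $e\in E(I(M))$ and suppose that $\Omega eM=\Omega$ (this happens, for instance, if $(\Omega,M)$ is transitive). Then the natural map $$\varphi\colon \mathrm{Ind}_e(K\Omega e)\to K\Omega$$ of $KM$-modules induced by the identity map on $K\Omega e$ is the projective cover of $K\Omega$.
   Context: A transformation monoid $(\Omega,M)$ is a non-empty set $\Omega$ with a submonoid $M$ of the monoid $T_\Omega$ of all self-maps of $\Omega$, acting on the right; it is finite if $\Omega$ is finite. It is transitive if $\alpha M=\Omega$ for all $\alpha\in\Omega$. $I(M)$ is the unique minimal two-sided ideal of the finite monoid $M$, and $E(X)$ is the set of idempotents in $X\subseteq M$. For an idempotent $e$, $G_e$ is the group of units of the monoid $eMe$ (whose identity is $e$); for $e\in E(I(M))$ one has $eMe=G_e$. $KM$ is the monoid algebra. The transformation module $K\Omega$ is the right $KM$-module with $K$-basis $\Omega$ and action extended linearly from the action of $M$ on $\Omega$. Then $K\Omega e$ is the right $KG_e$-module spanned by $\Omega e$. For $e\in E(I(M))$ and a right $KG_e$-module $V$, $\mathrm{Ind}_e(V)=V\otimes_{KG_e}eKM$, a right $KM$-module. The map $\varphi$ is given by $\varphi(v\otimes a)=va$ for $v\in K\Omega e$, $a\in eKM$. A projective cover of a finite-dimensional module $V$ over a finite-dimensional algebra is an epimorphism $\pi\colon P\to V$ with $P$ a projective module and $\ker\pi\subseteq\mathrm{rad}(P)$, where $\mathrm{rad}(P)$ is the intersection of all maximal submodules of $P$. *)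

theory Defs
  imports "HOL-Algebra.AbelCoset" "HOL-Algebra.Free_Abelian_Groups"
begin

section \<open>Finite monoids and transformation monoids\<close>

text \<open>
  Self-maps act on the right: the image of \<open>\<alpha>\<close> under \<open>m\<close>, written \<open>\<alpha>m\<close> on paper, is
  \<open>m \<alpha>\<close>, and the product \<open>m \<otimes> n\<close> means ``first \<open>m\<close>, then \<open>n\<close>''. The set acted upon is the
  type \<open>'a\<close>; a transformation monoid is given by a submonoid of \<^term>\<open>full_transf\<close>.
\<close>

definition full_transf :: "('a \<Rightarrow> 'a) monoid"
  where "full_transf = \<lparr>carrier = UNIV, monoid.mult = (\<lambda>m n. n \<circ> m), one = id\<rparr>"

definition transf_monoid :: "('a \<Rightarrow> 'a) set \<Rightarrow> ('a \<Rightarrow> 'a) monoid"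
  where "transf_monoid M = full_transf\<lparr>carrier := M\<rparr>"

definition transitive_transf :: "('a \<Rightarrow> 'a) set \<Rightarrow> bool"
  where "transitive_transf M \<longleftrightarrow> (\<forall>\<alpha>. {m \<alpha> |m. m \<in> M} = UNIV)"

definition monoid_ideal :: "('s, 'x) monoid_scheme \<Rightarrow> 's set \<Rightarrow> bool"
  where "monoid_ideal S I \<longleftrightarrow> I \<subseteq> carrier S \<and> I \<noteq> {} \<and>
    (\<forall>x\<in>I. \<forall>s\<in>carrier S. x \<otimes>\<^bsub>S\<^esub> s \<in> I \<and> s \<otimes>\<^bsub>S\<^esub> x \<in> I)"

text \<open>A finite monoid has exactly one minimal (nonempty, two-sided) ideal.\<close>

definition minimal_ideal :: "('s, 'x) monoid_scheme \<Rightarrow> 's set"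
  where "minimal_ideal S =
    (THE I. monoid_ideal S I \<and> (\<forall>J. monoid_ideal S J \<and> J \<subseteq> I \<longrightarrow> J = I))"

definition idempotents :: "('s, 'x) monoid_scheme \<Rightarrow> 's set \<Rightarrow> 's set"
  where "idempotents S Y = {x \<in> Y. x \<otimes>\<^bsub>S\<^esub> x = x}"

definition local_monoid :: "'s monoid \<Rightarrow> 's \<Rightarrow> 's monoid"
  where "local_monoid S e =
    S\<lparr>carrier := {e \<otimes>\<^bsub>S\<^esub> m \<otimes>\<^bsub>S\<^esub> e |m. m \<in> carrier S}, one := e\<rparr>"

definition local_group :: "'s monoid \<Rightarrow> 's \<Rightarrow> 's monoid"
  where "local_group S e = units_of (local_monoid S e)"


section \<open>Right modules over a ring\<close>

text \<open>
  As in the library's record for modules over commutative rings, only the additive part of the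
  underlying ring record is meaningful for a module.
\<close>

record ('r, 'm) rmodule = "'m ring" +
  ract :: "['m, 'r] \<Rightarrow> 'm" (infixl \<open>\<bullet>\<index>\<close> 70)

record ('l, 'r, 'm) bimodule = "('r, 'm) rmodule" +
  lact :: "['l, 'm] \<Rightarrow> 'm"

locale right_module = R?: ring R + V?: abelian_group V
  for R :: "('r, 'x) ring_scheme" and V :: "('r, 'm, 'y) rmodule_scheme" +
  assumes ract_closed:
      "\<lbrakk>v \<in> carrier V; r \<in> carrier R\<rbrakk> \<Longrightarrow> v \<bullet>\<^bsub>V\<^esub> r \<in> carrier V"
    and ract_add:
      "\<lbrakk>v \<in> carrier V; w \<in> carrier V; r \<in> carrier R\<rbrakk> \<Longrightarrow>
        (v \<oplus>\<^bsub>V\<^esub> w) \<bullet>\<^bsub>V\<^esub> r = v \<bullet>\<^bsub>V\<^esub> r \<oplus>\<^bsub>V\<^esub> w \<bullet>\<^bsub>V\<^esub> r"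
    and add_ract:
      "\<lbrakk>v \<in> carrier V; r \<in> carrier R; s \<in> carrier R\<rbrakk> \<Longrightarrow>
        v \<bullet>\<^bsub>V\<^esub> (r \<oplus>\<^bsub>R\<^esub> s) = v \<bullet>\<^bsub>V\<^esub> r \<oplus>\<^bsub>V\<^esub> v \<bullet>\<^bsub>V\<^esub> s"
    and ract_mult:
      "\<lbrakk>v \<in> carrier V; r \<in> carrier R; s \<in> carrier R\<rbrakk> \<Longrightarrow>
        v \<bullet>\<^bsub>V\<^esub> (r \<otimes>\<^bsub>R\<^esub> s) = (v \<bullet>\<^bsub>V\<^esub> r) \<bullet>\<^bsub>V\<^esub> s"
    and ract_one:
      "v \<in> carrier V \<Longrightarrow> v \<bullet>\<^bsub>V\<^esub> \<one>\<^bsub>R\<^esub> = v"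

definition rmodule_hom ::
    "('r, 'x) ring_scheme \<Rightarrow> ('r, 'm, 'y) rmodule_scheme \<Rightarrow> ('r, 'n, 'z) rmodule_scheme
      \<Rightarrow> ('m \<Rightarrow> 'n) set"
  where "rmodule_hom R V W = {h \<in> hom (add_monoid V) (add_monoid W).
    \<forall>v\<in>carrier V. \<forall>r\<in>carrier R. h (v \<bullet>\<^bsub>V\<^esub> r) = h v \<bullet>\<^bsub>W\<^esub> r}"

definition rmodule_epi ::
    "('r, 'x) ring_scheme \<Rightarrow> ('r, 'm, 'y) rmodule_scheme \<Rightarrow> ('r, 'n, 'z) rmodule_scheme
      \<Rightarrow> ('m \<Rightarrow> 'n) set"
  where "rmodule_epi R V W = {h \<in> rmodule_hom R V W. h ` carrier V = carrier W}"

definition submodule_of ::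
    "('r, 'x) ring_scheme \<Rightarrow> 'm set \<Rightarrow> ('r, 'm, 'y) rmodule_scheme \<Rightarrow> bool"
  where "submodule_of R N V \<longleftrightarrow> additive_subgroup N V \<and>
    (\<forall>v\<in>N. \<forall>r\<in>carrier R. v \<bullet>\<^bsub>V\<^esub> r \<in> N)"

definition maximal_submodule_of ::
    "('r, 'x) ring_scheme \<Rightarrow> 'm set \<Rightarrow> ('r, 'm, 'y) rmodule_scheme \<Rightarrow> bool"
  where "maximal_submodule_of R N V \<longleftrightarrow> submodule_of R N V \<and> N \<noteq> carrier V \<and>
    (\<forall>L. submodule_of R L V \<and> N \<subseteq> L \<longrightarrow> L = N \<or> L = carrier V)"

definition rmodule_rad ::
    "('r, 'x) ring_scheme \<Rightarrow> ('r, 'm, 'y) rmodule_scheme \<Rightarrow> 'm set"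
  where "rmodule_rad R V = {v \<in> carrier V. \<forall>N. maximal_submodule_of R N V \<longrightarrow> v \<in> N}"

text \<open>
  Projectivity is the lifting property against all epimorphisms \<open>g : A \<rightarrow> B\<close>. A definition cannot
  quantify over types, so the types of the elements of \<open>A\<close> and \<open>B\<close> are parameters; a theorem in
  which they are type variables asserts the lifting property against all epimorphisms.
\<close>

definition projective_rmodule ::
    "'a itself \<Rightarrow> 'b itself \<Rightarrow> 'r ring \<Rightarrow> ('r, 'm) rmodule \<Rightarrow> bool"
  where "projective_rmodule (_ :: 'a itself) (_ :: 'b itself) R P \<longleftrightarrow>
    right_module R P \<and>
    (\<forall>(A :: ('r, 'a) rmodule) (B :: ('r, 'b) rmodule) g f.
      right_module R A \<and> right_module R B \<and> g \<in> rmodule_epi R A B \<and> f \<in> rmodule_hom R P B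
      \<longrightarrow> (\<exists>h\<in>rmodule_hom R P A. \<forall>x\<in>carrier P. g (h x) = f x))"

definition projective_cover ::
    "'a itself \<Rightarrow> 'b itself \<Rightarrow> 'r ring \<Rightarrow> ('r, 'm) rmodule \<Rightarrow> ('r, 'n) rmodule
      \<Rightarrow> ('m \<Rightarrow> 'n) \<Rightarrow> bool"
  where "projective_cover TA TB R P V \<pi> \<longleftrightarrow>
    right_module R V \<and> projective_rmodule TA TB R P \<and>
    \<pi> \<in> rmodule_epi R P V \<and> a_kernel P V \<pi> \<subseteq> rmodule_rad R P"


section \<open>Tensor products\<close>

text \<open>
  For a right \<open>R\<close>-module \<open>V\<close> and a bimodule \<open>W\<close> (left action of \<open>R\<close>, right action of a second
  ring), \<open>V \<otimes>\<^sub>R W\<close> is the free abelian group on \<open>V \<times> W\<close> modulo the subgroup generated by the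
  biadditivity and balancing relations. Its elements are cosets of formal integer combinations of
  pairs; the second ring acts by \<open>(v \<otimes> w)s = v \<otimes> ws\<close>, extended additively.
\<close>

definition tensor_free ::
    "('r, 'm) rmodule \<Rightarrow> ('r, 's, 'n) bimodule \<Rightarrow> (('m \<times> 'n) \<Rightarrow>\<^sub>0 int) monoid"
  where "tensor_free V W = free_Abelian_group (carrier V \<times> carrier W)"

definition tensor_relations ::
    "'r ring \<Rightarrow> ('r, 'm) rmodule \<Rightarrow> ('r, 's, 'n) bimodule \<Rightarrow> (('m \<times> 'n) \<Rightarrow>\<^sub>0 int) set"
  where "tensor_relations R V W =
    {frag_of (v \<oplus>\<^bsub>V\<^esub> v', w) - frag_of (v, w) - frag_of (v', w) |v v' w.
      v \<in> carrier V \<and> v' \<in> carrier V \<and> w \<in> carrier W} \<union>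
    {frag_of (v, w \<oplus>\<^bsub>W\<^esub> w') - frag_of (v, w) - frag_of (v, w') |v w w'.
      v \<in> carrier V \<and> w \<in> carrier W \<and> w' \<in> carrier W} \<union>
    {frag_of (v \<bullet>\<^bsub>V\<^esub> r, w) - frag_of (v, lact W r w) |v r w.
      v \<in> carrier V \<and> r \<in> carrier R \<and> w \<in> carrier W}"

definition tensor_kernel ::
    "'r ring \<Rightarrow> ('r, 'm) rmodule \<Rightarrow> ('r, 's, 'n) bimodule \<Rightarrow> (('m \<times> 'n) \<Rightarrow>\<^sub>0 int) set"
  where "tensor_kernel R V W = generate (tensor_free V W) (tensor_relations R V W)"

definition pure_tensor ::
    "'r ring \<Rightarrow> ('r, 'm) rmodule \<Rightarrow> ('r, 's, 'n) bimodule \<Rightarrow> 'm \<Rightarrow> 'n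
      \<Rightarrow> (('m \<times> 'n) \<Rightarrow>\<^sub>0 int) set"
  where "pure_tensor R V W v w = tensor_kernel R V W #>\<^bsub>tensor_free V W\<^esub> frag_of (v, w)"

definition tensor ::
    "'r ring \<Rightarrow> ('r, 'm) rmodule \<Rightarrow> ('r, 's, 'n) bimodule
      \<Rightarrow> ('s, (('m \<times> 'n) \<Rightarrow>\<^sub>0 int) set) rmodule"
  where "tensor R V W =
    (let Q = tensor_free V W Mod tensor_kernel R V W in
     \<lparr>carrier = carrier Q, monoid.mult = undefined, one = undefined,
      ring.zero = one Q, ring.add = monoid.mult Q,
      ract = (\<lambda>Y s. \<Union>c\<in>Y. tensor_kernel R V W #>\<^bsub>tensor_free V W\<^esub>
        frag_extend (\<lambda>(v, w). frag_of (v, w \<bullet>\<^bsub>W\<^esub> s)) c)\<rparr>)"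

text \<open>
  The map on a tensor product induced by a balanced biadditive map \<open>b\<close> into \<open>U\<close>: the additive
  extension of \<open>b\<close> to formal combinations is constant on each coset \<open>Y\<close>.
\<close>

definition tensor_lift ::
    "('s, 'u) rmodule \<Rightarrow> ('m \<Rightarrow> 'n \<Rightarrow> 'u) \<Rightarrow> (('m \<times> 'n) \<Rightarrow>\<^sub>0 int) set \<Rightarrow> 'u"
  where "tensor_lift U b Y = the_elem
    ((\<lambda>c. \<Oplus>\<^bsub>U\<^esub>p\<in>Poly_Mapping.keys c. [Poly_Mapping.lookup c p] \<cdot>\<^bsub>U\<^esub> b (fst p) (snd p)) ` Y)"


section \<open>Monoid algebras, transformation modules and induction\<close>

definition basis_elt :: "'s \<Rightarrow> 's \<Rightarrow> 'k::field"
  where "basis_elt s = (\<lambda>t. if t = s then 1 else 0)"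

text \<open>
  The monoid algebra of a monoid with finite carrier. Elements are coefficient functions on the
  whole type that vanish off the carrier, so that \<open>KG\<^sub>e\<close> is literally a subset of \<open>KM\<close>.
\<close>

definition monoid_algebra :: "'s monoid \<Rightarrow> ('s \<Rightarrow> 'k::field) ring"
  where "monoid_algebra S =
    \<lparr>carrier = {f. \<forall>s. s \<notin> carrier S \<longrightarrow> f s = 0},
     monoid.mult = (\<lambda>f g p. \<Sum>m\<in>carrier S. \<Sum>n\<in>carrier S. if m \<otimes>\<^bsub>S\<^esub> n = p then f m * g n else 0),
     one = basis_elt \<one>\<^bsub>S\<^esub>,
     ring.zero = (\<lambda>_. 0), ring.add = (\<lambda>f g p. f p + g p)\<rparr>"

definition transf_module :: "('a::finite \<Rightarrow> 'a) set \<Rightarrow> (('a \<Rightarrow> 'a) \<Rightarrow> 'k::field, 'a \<Rightarrow> 'k) rmodule"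
  where "transf_module M =
    \<lparr>carrier = UNIV, monoid.mult = undefined, one = undefined,
     ring.zero = (\<lambda>_. 0), ring.add = (\<lambda>v w \<beta>. v \<beta> + w \<beta>),
     ract = (\<lambda>v f \<beta>. \<Sum>\<alpha>\<in>UNIV. \<Sum>m\<in>M. if m \<alpha> = \<beta> then v \<alpha> * f m else 0)\<rparr>"

text \<open>
  For a right \<open>KM\<close>-module \<open>V\<close>, the right \<open>KG\<^sub>e\<close>-module \<open>Ve\<close>, with the action restricted
  along \<open>KG\<^sub>e \<subseteq> KM\<close>.
\<close>

definition times_idem :: "('s \<Rightarrow> 'k::field, 'm) rmodule \<Rightarrow> 's \<Rightarrow> ('s \<Rightarrow> 'k, 'm) rmodule"
  where "times_idem V e = V\<lparr>carrier := {v \<bullet>\<^bsub>V\<^esub> basis_elt e |v. v \<in> carrier V}\<rparr>"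

text \<open>\<open>eKM\<close>, with \<open>KG\<^sub>e\<close> acting on the left and \<open>KM\<close> on the right by multiplication in \<open>KM\<close>.\<close>

definition idem_bimodule ::
    "'s monoid \<Rightarrow> 's \<Rightarrow> ('s \<Rightarrow> 'k::field, 's \<Rightarrow> 'k, 's \<Rightarrow> 'k) bimodule"
  where "idem_bimodule S e =
    (let A = monoid_algebra S in
     \<lparr>carrier = {basis_elt e \<otimes>\<^bsub>A\<^esub> a |a. a \<in> carrier A}, monoid.mult = undefined, one = undefined,
      ring.zero = ring.zero A, ring.add = ring.add A, ract = monoid.mult A, lact = monoid.mult A\<rparr>)"

definition Ind ::
    "'s monoid \<Rightarrow> 's \<Rightarrow> ('s \<Rightarrow> 'k::field, 'm) rmodule
      \<Rightarrow> ('s \<Rightarrow> 'k, (('m \<times> ('s \<Rightarrow> 'k)) \<Rightarrow>\<^sub>0 int) set) rmodule"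
  where "Ind S e V = tensor (monoid_algebra (local_group S e)) V (idem_bimodule S e)"

definition Ind_tensor ::
    "'s monoid \<Rightarrow> 's \<Rightarrow> ('s \<Rightarrow> 'k::field, 'm) rmodule \<Rightarrow> 'm \<Rightarrow> ('s \<Rightarrow> 'k)
      \<Rightarrow> (('m \<times> ('s \<Rightarrow> 'k)) \<Rightarrow>\<^sub>0 int) set"
  where "Ind_tensor S e V = pure_tensor (monoid_algebra (local_group S e)) V (idem_bimodule S e)"

text \<open>The natural map \<open>Ind\<^sub>e(Ue) \<rightarrow> U\<close>, \<open>v \<otimes> a \<mapsto> va\<close>, for a right \<open>KM\<close>-module \<open>U\<close>.\<close>

definition Ind_natural ::
    "('s \<Rightarrow> 'k::field, 'm) rmodule \<Rightarrow> (('m \<times> ('s \<Rightarrow> 'k)) \<Rightarrow>\<^sub>0 int) set \<Rightarrow> 'm"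
  where "Ind_natural U = tensor_lift U (ract U)"

end

theory Submission
  imports Defs
begin

text \<open>
  Write \<open>V = K\<Omega>e\<close>, \<open>G = G\<^sub>e\<close> and \<open>P = V \<otimes>\<^bsub>KG\<^esub> eKM\<close>. The argument rests on \<open>eMe = G\<close>: since the
  ideal generated by \<open>eme\<close> is the minimal one, \<open>e = (eae)(eme)(ebe)\<close> for some \<open>a, b\<close>, and in the
  finite monoid \<open>eMe\<close> this makes \<open>eme\<close> a unit (\<open>local_group_minimal_ideal\<close>).

  The kernel is in the radical. As \<open>eKMe = KG\<close>, every \<open>x \<in> P\<close> satisfies \<open>xe = \<phi>(x)e \<otimes> e\<close>
  (\<open>Ind_ract_idem\<close>), so \<open>e\<close> annihilates \<open>ker \<phi>\<close>. If a maximal submodule \<open>L\<close> missed some element of the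
  kernel, then \<open>L + ker \<phi> = P\<close>, hence \<open>Pe = Le \<subseteq> L\<close>; but \<open>Pe\<close> contains all \<open>v \<otimes> e\<close>, which
  generate \<open>P\<close>, so \<open>L = P\<close> (\<open>kernel_natural_rad\<close>). This half of the proof is carried out for an
  arbitrary right \<open>KM\<close>-module \<open>U\<close> in place of \<open>K\<Omega>\<close>.

  Projectivity is where characteristic zero enters. The group \<open>G\<close> permutes the basis \<open>\<Omega>e\<close> of \<open>V\<close>, and
  averaging over \<open>G\<close> gives \<open>KG\<close>-linear coordinates
  \<open>c\<^sub>\<beta>(v) = (1/|G|) \<Sum>\<^bsub>g\<in>G\<^esub> v(\<beta>g) g\<close> with \<open>v = \<Sum>\<^bsub>\<beta>\<in>\<Omega>e\<^esub> \<beta> c\<^sub>\<beta>(v)\<close>, where \<open>v(\<beta>g)\<close> is the coefficient of \<open>v\<close> at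
  \<open>\<beta>g\<close>. Such a dual basis of \<open>V\<close> over \<open>KG\<close> induces the dual basis \<open>\<beta> \<otimes> e\<close>, \<open>v \<otimes> a \<mapsto> c\<^sub>\<beta>(v)a\<close> of \<open>P\<close>
  over \<open>KM\<close> (\<open>projective_Ind_dual_basis\<close>), and a module with a finite dual basis is projective because
  lifts of the images of the basis elements determine a lift of the whole map
  (\<open>projective_rmodule_dual_basis\<close>).

  Surjectivity of \<open>\<phi>\<close> is the hypothesis \<open>\<Omega>eM = \<Omega>\<close>: the point \<open>(\<alpha>e)m\<close> is the image of \<open>\<alpha>e \<otimes> em\<close>.
\<close>

section \<open>Additive maps between modules\<close>

context right_module
begin

lemma ract_hom: "r \<in> carrier R \<Longrightarrow> (\<lambda>v. v \<bullet>\<^bsub>V\<^esub> r) \<in> hom (add_monoid V) (add_monoid V)"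
  by (auto simp: hom_def ract_closed ract_add)

lemma ract_hom_right: "v \<in> carrier V \<Longrightarrow> (\<lambda>r. v \<bullet>\<^bsub>V\<^esub> r) \<in> hom (add_monoid R) (add_monoid V)"
  by (auto simp: hom_def ract_closed add_ract)

end

lemma additive_hom_group_hom:
  assumes "abelian_group V" "abelian_group W" "h \<in> hom (add_monoid V) (add_monoid W)"
  shows "group_hom (add_monoid V) (add_monoid W) h"
  using assms by (simp add: abelian_group.a_group group_hom.intro group_hom_axioms.intro)

lemma additive_hom_closed:
  "h \<in> hom (add_monoid V) (add_monoid W) \<Longrightarrow> v \<in> carrier V \<Longrightarrow> h v \<in> carrier W"
  by (auto simp: hom_def)

lemma additive_hom_add:
  "h \<in> hom (add_monoid V) (add_monoid W) \<Longrightarrow> v \<in> carrier V \<Longrightarrow> w \<in> carrier V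
    \<Longrightarrow> h (v \<oplus>\<^bsub>V\<^esub> w) = h v \<oplus>\<^bsub>W\<^esub> h w"
  by (auto simp: hom_def)

lemma additive_hom_zero:
  assumes "abelian_group V" "abelian_group W" "h \<in> hom (add_monoid V) (add_monoid W)"
  shows "h \<zero>\<^bsub>V\<^esub> = \<zero>\<^bsub>W\<^esub>"
  using group_hom.hom_one[OF additive_hom_group_hom[OF assms]] by simp

lemma additive_hom_minus:
  assumes "abelian_group V" "abelian_group W" "h \<in> hom (add_monoid V) (add_monoid W)"
    "v \<in> carrier V"
  shows "h (\<ominus>\<^bsub>V\<^esub> v) = \<ominus>\<^bsub>W\<^esub> h v"
  using group_hom.hom_inv[OF additive_hom_group_hom[OF assms(1-3)]] assms(4)
  by (simp add: a_inv_def)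

lemma additive_hom_finsum:
  assumes V: "abelian_group V" and W: "abelian_group W"
    and h: "h \<in> hom (add_monoid V) (add_monoid W)"
    and "finite A" "f \<in> A \<rightarrow> carrier V"
  shows "h (\<Oplus>\<^bsub>V\<^esub>i\<in>A. f i) = (\<Oplus>\<^bsub>W\<^esub>i\<in>A. h (f i))"
  using assms(4,5)
proof (induction A rule: finite_induct)
  case empty
  interpret V: abelian_group V by (rule V)
  interpret W: abelian_group W by (rule W)
  show ?case by (simp add: additive_hom_zero[OF V W h])
next
  case (insert x A)
  interpret V: abelian_group V by (rule V)
  interpret W: abelian_group W by (rule W)
  have "(\<lambda>i. h (f i)) \<in> A \<rightarrow> carrier W"
    using insert.prems by (auto intro!: additive_hom_closed[OF h])
  with insert show ?case
    by (auto simp: additive_hom_add[OF h] additive_hom_closed[OF h] Pi_iff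
        intro!: V.finsum_closed)
qed

lemma finsum_hom:
  assumes V: "abelian_group V" and W: "abelian_group W"
    and h: "\<And>i. i \<in> I \<Longrightarrow> h i \<in> hom (add_monoid V) (add_monoid W)"
  shows "(\<lambda>v. \<Oplus>\<^bsub>W\<^esub>i\<in>I. h i v) \<in> hom (add_monoid V) (add_monoid W)"
proof -
  interpret W: abelian_group W by (rule W)
  show ?thesis
  proof (rule homI)
    fix v assume v: "v \<in> carrier (add_monoid V)"
    then show "(\<Oplus>\<^bsub>W\<^esub>i\<in>I. h i v) \<in> carrier (add_monoid W)"
      by (auto intro!: W.finsum_closed additive_hom_closed[OF h])
    fix w assume w: "w \<in> carrier (add_monoid V)"
    have "(\<Oplus>\<^bsub>W\<^esub>i\<in>I. h i (v \<oplus>\<^bsub>V\<^esub> w)) = (\<Oplus>\<^bsub>W\<^esub>i\<in>I. h i v \<oplus>\<^bsub>W\<^esub> h i w)"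
      using v w by (intro W.finsum_cong') (auto simp: additive_hom_add[OF h] additive_hom_closed[OF h])
    also have "\<dots> = (\<Oplus>\<^bsub>W\<^esub>i\<in>I. h i v) \<oplus>\<^bsub>W\<^esub> (\<Oplus>\<^bsub>W\<^esub>i\<in>I. h i w)"
      using v w by (intro W.finsum_addf) (auto simp: additive_hom_closed[OF h])
    finally show "(\<Oplus>\<^bsub>W\<^esub>i\<in>I. h i (v \<otimes>\<^bsub>add_monoid V\<^esub> w)) =
        (\<Oplus>\<^bsub>W\<^esub>i\<in>I. h i v) \<otimes>\<^bsub>add_monoid W\<^esub> (\<Oplus>\<^bsub>W\<^esub>i\<in>I. h i w)"
      by simp
  qed
qed

lemma abelian_group_restrict:
  assumes "abelian_group V" "additive_subgroup H V"
  shows "abelian_group (V\<lparr>carrier := H\<rparr>)"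
proof -
  interpret V: abelian_group V by fact
  interpret H: additive_subgroup H V by fact
  show ?thesis
  proof (rule abelian_groupI)
    fix x assume "x \<in> carrier (V\<lparr>carrier := H\<rparr>)"
    then show "\<exists>y\<in>carrier (V\<lparr>carrier := H\<rparr>). y \<oplus>\<^bsub>V\<lparr>carrier := H\<rparr>\<^esub> x = \<zero>\<^bsub>V\<lparr>carrier := H\<rparr>\<^esub>"
      using H.a_inv_closed V.l_neg H.a_subset by auto
  qed (use H.a_subset in \<open>auto intro: V.a_assoc V.a_comm\<close>)
qed

lemma additive_subgroup_image:
  assumes V: "abelian_group V" and W: "abelian_group W"
    and h: "h \<in> hom (add_monoid V) (add_monoid W)"
  shows "additive_subgroup (h ` carrier V) W"
  using group_hom.img_is_subgroup[OF additive_hom_group_hom[OF assms]]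
  by (simp add: additive_subgroup_def)

text \<open>
  Applied to a generating set, this turns agreement of two additive maps on the generators into
  equality.
\<close>

lemma additive_subgroup_equalizer:
  assumes V: "abelian_group V" and W: "abelian_group W"
    and h: "h \<in> hom (add_monoid V) (add_monoid W)" and k: "k \<in> hom (add_monoid V) (add_monoid W)"
  shows "additive_subgroup {v \<in> carrier V. h v = k v} V"
proof -
  interpret V: abelian_group V by (rule V)
  interpret W: abelian_group W by (rule W)
  show ?thesis
    by (intro additive_subgroup.intro V.add.subgroupI)
      (auto simp: additive_hom_add[OF h] additive_hom_add[OF k] additive_hom_zero[OF V W h]
        additive_hom_zero[OF V W k] additive_hom_minus[OF V W h] additive_hom_minus[OF V W k] intro: V.zero_closed)
qed

lemma (in abelian_group) add_int_pow_0: "[(0::int)] \<cdot>\<^bsub>G\<^esub> x = \<zero>\<^bsub>G\<^esub>"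
  by (simp add: add_pow_def)

lemma (in abelian_group) add_int_pow:
  fixes i j :: int
  assumes "x \<in> carrier G"
  shows add_int_pow_closed: "[i] \<cdot>\<^bsub>G\<^esub> x \<in> carrier G"
    and add_int_pow_1: "[(1::int)] \<cdot>\<^bsub>G\<^esub> x = x"
    and add_int_pow_add: "[(i + j)] \<cdot>\<^bsub>G\<^esub> x = [i] \<cdot>\<^bsub>G\<^esub> x \<oplus>\<^bsub>G\<^esub> [j] \<cdot>\<^bsub>G\<^esub> x"
  using assms group.int_pow_closed[OF a_group, of x i] group.int_pow_1[OF a_group, of x]
    group.int_pow_mult[OF a_group, of x i j]
  by (simp_all add: add_pow_def)

section \<open>Tensor products\<close>

text \<open>
  That the two actions on \<open>W\<close> commute is what makes \<open>v \<otimes> w \<mapsto> v \<otimes> ws\<close> respect the balancing relation,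
  so that the second ring acts on the tensor product.
\<close>

locale tensor_product = V: right_module R V + W: right_module S W
  for R :: "'r ring" and S :: "'s ring"
    and V :: "('r, 'm) rmodule" and W :: "('r, 's, 'n) bimodule" +
  assumes lact_closed:
      "\<lbrakk>r \<in> carrier R; w \<in> carrier W\<rbrakk> \<Longrightarrow> lact W r w \<in> carrier W"
    and lact_ract:
      "\<lbrakk>r \<in> carrier R; w \<in> carrier W; s \<in> carrier S\<rbrakk> \<Longrightarrow>
        lact W r (w \<bullet>\<^bsub>W\<^esub> s) = lact W r w \<bullet>\<^bsub>W\<^esub> s"
begin

abbreviation (input) T where "T \<equiv> tensor R V W"
abbreviation (input) F where "F \<equiv> tensor_free V W"
abbreviation (input) N where "N \<equiv> tensor_kernel R V W"
abbreviation (input) pure where "pure \<equiv> pure_tensor R V W"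

definition coset :: "(('m \<times> 'n) \<Rightarrow>\<^sub>0 int) \<Rightarrow> (('m \<times> 'n) \<Rightarrow>\<^sub>0 int) set"
  where "coset c = N #>\<^bsub>F\<^esub> c"

lemma carrier_free: "c \<in> carrier F \<longleftrightarrow> Poly_Mapping.keys c \<subseteq> carrier V \<times> carrier W"
  by (simp add: tensor_free_def)

lemma mult_free: "x \<otimes>\<^bsub>F\<^esub> y = x + y" and one_free: "\<one>\<^bsub>F\<^esub> = 0"
  by (simp_all add: tensor_free_def)

lemma comm_group_free: "comm_group F"
  by (simp add: tensor_free_def abelian_free_Abelian_group)

lemma group_free: "group F"
  by (simp add: tensor_free_def)

lemma frag_of_free: "v \<in> carrier V \<Longrightarrow> w \<in> carrier W \<Longrightarrow> frag_of (v, w) \<in> carrier F"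
  by (simp add: carrier_free)

lemma diff_free: "a \<in> carrier F \<Longrightarrow> b \<in> carrier F \<Longrightarrow> a - b \<in> carrier F"
  using keys_diff[of a b] by (auto simp: carrier_free)

lemma relations_free: "tensor_relations R V W \<subseteq> carrier F"
  unfolding tensor_relations_def
  by (auto intro!: diff_free frag_of_free lact_closed V.ract_closed)

lemma subgroup_kernel: "subgroup N F"
  unfolding tensor_kernel_def by (rule group.generate_is_subgroup[OF group_free relations_free])

lemma normal_kernel: "N \<lhd> F"
  by (rule comm_group.subgroup_imp_normal[OF comm_group_free subgroup_kernel])

lemma comm_group_tensor: "comm_group (add_monoid T)"
proof -
  interpret Q: comm_group "F Mod N"
    by (rule comm_group.abelian_FactGroup[OF comm_group_free subgroup_kernel])
  show ?thesis
    by (rule comm_groupI)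
      (use Q.l_inv_ex in \<open>simp_all add: tensor_def Let_def Q.m_ac
        del: mult_FactGroup one_FactGroup\<close>)
qed

lemma abelian_group_tensor: "abelian_group T"
  using comm_group_tensor
  by (simp add: abelian_group_def abelian_group_axioms_def abelian_monoid_def comm_group_def)

lemma coset_hom: "coset \<in> hom F (add_monoid T)"
  using normal.rcos_sum[OF normal_kernel]
  by (auto simp: hom_def coset_def tensor_def Let_def FactGroup_def RCOSETS_def)

lemma coset_add:
  "c \<in> carrier F \<Longrightarrow> d \<in> carrier F \<Longrightarrow> coset (c + d) = coset c \<oplus>\<^bsub>T\<^esub> coset d"
  using coset_hom by (auto simp: hom_def mult_free)

lemma coset_closed: "c \<in> carrier F \<Longrightarrow> coset c \<in> carrier T"
  using coset_hom by (auto simp: hom_def)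

lemma tensor_cosetE:
  assumes "Y \<in> carrier T"
  obtains c where "c \<in> carrier F" "Y = coset c"
  using assms by (auto simp: tensor_def Let_def FactGroup_def RCOSETS_def coset_def)

lemma pure_coset: "pure v w = coset (frag_of (v, w))"
  by (simp add: pure_tensor_def coset_def)

lemma pure_closed: "v \<in> carrier V \<Longrightarrow> w \<in> carrier W \<Longrightarrow> pure v w \<in> carrier T"
  by (simp add: pure_coset coset_closed frag_of_free)

lemma coset_relation: "c \<in> tensor_relations R V W \<Longrightarrow> coset c = \<zero>\<^bsub>T\<^esub>"
proof -
  assume c: "c \<in> tensor_relations R V W"
  have "c \<in> N"
    unfolding tensor_kernel_def using c by (rule generate.incl)
  then have "coset c = N"
    unfolding coset_def using c relations_free subgroup_kernel
    by (intro group.coset_join2[OF group_free]) auto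
  then show ?thesis
    by (simp add: tensor_def Let_def FactGroup_def)
qed

lemma coset_diff:
  assumes "c \<in> carrier F" "d \<in> carrier F"
  shows "coset (c - d) = coset c \<ominus>\<^bsub>T\<^esub> coset d"
proof -
  interpret T: abelian_group T by (rule abelian_group_tensor)
  have "coset c = coset (c - d) \<oplus>\<^bsub>T\<^esub> coset d"
    using coset_add[OF diff_free[OF assms] assms(2)] by simp
  then show ?thesis
    using assms by (simp add: coset_closed diff_free a_minus_def T.a_assoc T.r_neg)
qed

lemma free_add_closed: "c \<in> carrier F \<Longrightarrow> d \<in> carrier F \<Longrightarrow> c + d \<in> carrier F"
  using keys_add[of c d] by (auto simp: carrier_free)

lemma coset_eq_addI:
  assumes "a \<in> carrier F" "b \<in> carrier F" "c \<in> carrier F"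
    and "a - b - c \<in> tensor_relations R V W"
  shows "coset a = coset b \<oplus>\<^bsub>T\<^esub> coset c"
proof -
  interpret T: abelian_group T by (rule abelian_group_tensor)
  have "coset a = coset (a - b - c) \<oplus>\<^bsub>T\<^esub> (coset b \<oplus>\<^bsub>T\<^esub> coset c)"
    using assms(1-3) coset_add[of "a - b - c" "b + c"] coset_add[of b c]
    by (simp add: diff_free free_add_closed)
  then show ?thesis
    using assms by (simp add: coset_relation coset_closed)
qed

lemma pure_add_left:
  assumes "v \<in> carrier V" "v' \<in> carrier V" "w \<in> carrier W"
  shows "pure (v \<oplus>\<^bsub>V\<^esub> v') w = pure v w \<oplus>\<^bsub>T\<^esub> pure v' w"
  unfolding pure_coset using assms
  by (intro coset_eq_addI frag_of_free) (simp_all, unfold tensor_relations_def, blast)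

lemma pure_add_right:
  assumes "v \<in> carrier V" "w \<in> carrier W" "w' \<in> carrier W"
  shows "pure v (w \<oplus>\<^bsub>W\<^esub> w') = pure v w \<oplus>\<^bsub>T\<^esub> pure v w'"
  unfolding pure_coset using assms
  by (intro coset_eq_addI frag_of_free) (simp_all, unfold tensor_relations_def, blast)

lemma pure_balanced:
  assumes "v \<in> carrier V" "r \<in> carrier R" "w \<in> carrier W"
  shows "pure (v \<bullet>\<^bsub>V\<^esub> r) w = pure v (lact W r w)"
proof -
  interpret T: abelian_group T by (rule abelian_group_tensor)
  let ?a = "frag_of (v \<bullet>\<^bsub>V\<^esub> r, w)" and ?b = "frag_of (v, lact W r w)"
  have F: "?a \<in> carrier F" "?b \<in> carrier F"
    using assms by (auto intro!: frag_of_free V.ract_closed lact_closed)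
  have "coset (?a - ?b) = \<zero>\<^bsub>T\<^esub>"
    using assms by (intro coset_relation) (unfold tensor_relations_def, blast)
  moreover have "coset ?a = coset (?a - ?b) \<oplus>\<^bsub>T\<^esub> coset ?b"
    using F coset_add[of "?a - ?b" ?b] by (simp add: diff_free)
  ultimately show ?thesis
    using F by (simp add: pure_coset coset_closed)
qed

text \<open>
  Sums of pure tensors exhaust the tensor product, since the free abelian group is generated by pairs.
  This is the induction principle for tensor products used from here on.
\<close>

lemma tensor_generated_by_pure:
  assumes "additive_subgroup L T"
    and pure: "\<And>v w. v \<in> carrier V \<Longrightarrow> w \<in> carrier W \<Longrightarrow> pure v w \<in> L"
  shows "L = carrier T"
proof
  interpret T: abelian_group T by (rule abelian_group_tensor)
  interpret L: additive_subgroup L T by fact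
  show "L \<subseteq> carrier T" by (rule L.a_subset)
  show "carrier T \<subseteq> L"
  proof
    fix Y assume "Y \<in> carrier T"
    then obtain c where c: "c \<in> carrier F" "Y = coset c" by (rule tensor_cosetE)
    from c(1) have "Poly_Mapping.keys c \<subseteq> carrier V \<times> carrier W"
      by (simp add: carrier_free)
    then have "c \<in> carrier F \<and> coset c \<in> L"
    proof (induction c rule: frag_induction)
      case zero
      have "coset 0 = \<zero>\<^bsub>T\<^esub>"
        by (simp add: coset_def tensor_def Let_def FactGroup_def
            group.coset_mult_one[OF group_free, unfolded one_free]
            subgroup.subset[OF subgroup_kernel])
      then show ?case
        using L.zero_closed by (simp add: carrier_free)
    next
      case (one p)
      then show ?case
        using pure by (auto simp: pure_coset frag_of_free)
    next
      case (diff a b)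
      then show ?case
        by (auto simp: diff_free coset_diff a_minus_def intro!: L.a_closed L.a_inv_closed)
    qed
    then show "Y \<in> L" using c by simp
  qed
qed

lemma tensor_hom_eqI:
  assumes "abelian_group U" "h \<in> hom (add_monoid T) (add_monoid U)"
    "k \<in> hom (add_monoid T) (add_monoid U)"
    and "\<And>v w. v \<in> carrier V \<Longrightarrow> w \<in> carrier W \<Longrightarrow> h (pure v w) = k (pure v w)"
    and "x \<in> carrier T"
  shows "h x = k x"
  using tensor_generated_by_pure[OF additive_subgroup_equalizer[OF abelian_group_tensor assms(1-3)]]
    assms(4,5) pure_closed by blast

lemma hom_trivial_on_kernel:
  assumes "group H" and h: "h \<in> hom F H"
    and "\<And>c. c \<in> tensor_relations R V W \<Longrightarrow> h c = \<one>\<^bsub>H\<^esub>" and "c \<in> N"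
  shows "h c = \<one>\<^bsub>H\<^esub>"
proof -
  interpret h: group_hom F H h
    using assms group_free by (simp add: group_hom.intro group_hom_axioms.intro)
  have "N \<subseteq> kernel F H h"
    unfolding tensor_kernel_def
    by (rule h.G.generate_subgroup_incl[OF _ h.subgroup_kernel])
      (use assms(3) relations_free in \<open>auto simp: kernel_def\<close>)
  then show ?thesis using assms(4) by (auto simp: kernel_def)
qed

text \<open>
  Both the right action on cosets and \<^const>\<open>tensor_lift\<close> are defined by applying a map to all
  representatives at once; a homomorphism that kills the relations takes a single value on a coset, which
  makes both definitions computable on representatives.
\<close>

lemma hom_image_coset:
  assumes "group H" and h: "h \<in> hom F H"
    and "\<And>c. c \<in> tensor_relations R V W \<Longrightarrow> h c = \<one>\<^bsub>H\<^esub>" and c: "c \<in> carrier F"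
  shows "h ` coset c = {h c}"
proof -
  interpret H: group H by fact
  have "h d = h c" if d: "d \<in> coset c" for d
  proof -
    from d obtain n where n: "n \<in> N" "d = n \<otimes>\<^bsub>F\<^esub> c"
      by (auto simp: coset_def r_coset_def)
    moreover have "n \<in> carrier F"
      using n subgroup.subset[OF subgroup_kernel] by auto
    ultimately have "h d = h n \<otimes>\<^bsub>H\<^esub> h c"
      using h c by (auto simp: hom_def)
    then show ?thesis
      using hom_trivial_on_kernel[OF assms(1-3) n(1)] hom_in_carrier[OF h c] by simp
  qed
  moreover have "c \<in> coset c"
    unfolding coset_def by (rule group.rcos_self[OF group_free c subgroup_kernel])
  ultimately show ?thesis by blast
qed

subsection \<open>The right action\<close>

definition free_act :: "'s \<Rightarrow> (('m \<times> 'n) \<Rightarrow>\<^sub>0 int) \<Rightarrow> (('m \<times> 'n) \<Rightarrow>\<^sub>0 int)"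
  where "free_act s = frag_extend (\<lambda>(v, w). frag_of (v, w \<bullet>\<^bsub>W\<^esub> s))"

lemma free_act_of: "free_act s (frag_of (v, w)) = frag_of (v, w \<bullet>\<^bsub>W\<^esub> s)"
  by (simp add: free_act_def)

lemma free_act_add: "free_act s (c + d) = free_act s c + free_act s d"
  by (simp add: free_act_def frag_extend_add)

lemma free_act_closed:
  assumes "s \<in> carrier S" "c \<in> carrier F"
  shows "free_act s c \<in> carrier F"
proof -
  have "Poly_Mapping.keys (free_act s c)
      \<subseteq> (\<Union>x\<in>Poly_Mapping.keys c. Poly_Mapping.keys (case x of (v, w) \<Rightarrow> frag_of (v, w \<bullet>\<^bsub>W\<^esub> s)))"
    unfolding free_act_def by (rule keys_frag_extend)
  also have "\<dots> \<subseteq> carrier V \<times> carrier W"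
    using assms by (fastforce simp: carrier_free W.ract_closed)
  finally show ?thesis by (simp add: carrier_free)
qed

lemma coset_free_act_hom:
  assumes "s \<in> carrier S"
  shows "(\<lambda>c. coset (free_act s c)) \<in> hom F (add_monoid T)"
  using assms
  by (auto simp: hom_def coset_closed free_act_closed mult_free coset_add free_act_add)

lemma free_act_relation:
  assumes "s \<in> carrier S" "c \<in> tensor_relations R V W"
  shows "free_act s c \<in> tensor_relations R V W"
proof -
  have diff: "free_act s (a - b) = free_act s a - free_act s b" for a b
    by (simp add: free_act_def frag_extend_diff)
  from assms(2) consider
    (l) v v' w where "c = frag_of (v \<oplus>\<^bsub>V\<^esub> v', w) - frag_of (v, w) - frag_of (v', w)"
      "v \<in> carrier V" "v' \<in> carrier V" "w \<in> carrier W"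
    | (r) v w w' where "c = frag_of (v, w \<oplus>\<^bsub>W\<^esub> w') - frag_of (v, w) - frag_of (v, w')"
      "v \<in> carrier V" "w \<in> carrier W" "w' \<in> carrier W"
    | (b) v r w where "c = frag_of (v \<bullet>\<^bsub>V\<^esub> r, w) - frag_of (v, lact W r w)"
      "v \<in> carrier V" "r \<in> carrier R" "w \<in> carrier W"
    unfolding tensor_relations_def by blast
  then show ?thesis
  proof cases
    case l
    then show ?thesis
      unfolding tensor_relations_def l(1) diff free_act_of
      using W.ract_closed[OF _ assms(1)] by blast
  next
    case r
    then show ?thesis
      unfolding tensor_relations_def r(1) diff free_act_of W.ract_add[OF r(3,4) assms(1)]
      using W.ract_closed[OF _ assms(1)] by blast
  next
    case b
    then show ?thesis
      unfolding tensor_relations_def b(1) diff free_act_of lact_ract[OF b(3,4) assms(1), symmetric]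
      using W.ract_closed[OF _ assms(1)] by blast
  qed
qed

lemma coset_ract:
  assumes "s \<in> carrier S" "c \<in> carrier F"
  shows "coset c \<bullet>\<^bsub>T\<^esub> s = coset (free_act s c)"
proof -
  interpret T: comm_group "add_monoid T" by (rule comm_group_tensor)
  have "(\<lambda>c. coset (free_act s c)) ` coset c = {coset (free_act s c)}"
    using assms
    by (intro hom_image_coset[OF T.is_group coset_free_act_hom])
      (auto simp: coset_relation free_act_relation)
  moreover have "coset c \<bullet>\<^bsub>T\<^esub> s = (\<Union>c\<in>coset c. coset (free_act s c))"
    by (simp add: tensor_def Let_def coset_def free_act_def)
  ultimately show ?thesis by (metis (no_types) ccpo_Sup_singleton)
qed

lemma pure_ract:
  assumes "v \<in> carrier V" "w \<in> carrier W" "s \<in> carrier S"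
  shows "pure v w \<bullet>\<^bsub>T\<^esub> s = pure v (w \<bullet>\<^bsub>W\<^esub> s)"
  using assms by (simp add: pure_coset coset_ract frag_of_free free_act_of)

lemma tensor_ract_hom:
  assumes "s \<in> carrier S"
  shows "(\<lambda>x. x \<bullet>\<^bsub>T\<^esub> s) \<in> hom (add_monoid T) (add_monoid T)"
proof (rule homI)
  fix x y assume "x \<in> carrier (add_monoid T)" "y \<in> carrier (add_monoid T)"
  then obtain c d where c: "c \<in> carrier F" "x = coset c" and d: "d \<in> carrier F" "y = coset d"
    by (auto elim!: tensor_cosetE)
  then show "(x \<otimes>\<^bsub>add_monoid T\<^esub> y) \<bullet>\<^bsub>T\<^esub> s = x \<bullet>\<^bsub>T\<^esub> s \<otimes>\<^bsub>add_monoid T\<^esub> (y \<bullet>\<^bsub>T\<^esub> s)"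
    using coset_ract[OF assms free_add_closed[of c d]] assms
    by (simp add: coset_ract coset_add free_act_closed free_act_add)
qed (auto elim!: tensor_cosetE simp: assms coset_ract coset_closed free_act_closed)

text \<open>
  Once the action of each ring element is known to be additive, the remaining axioms are equations between
  additive maps and need only be checked on pure tensors.
\<close>

lemma right_module_tensor: "right_module S T"
proof -
  interpret T: abelian_group T by (rule abelian_group_tensor)
  note cl = additive_hom_closed[OF tensor_ract_hom]
  show ?thesis
  proof (intro right_module.intro right_module_axioms.intro)
    show "ring S" by (rule W.R.ring_axioms)
    show "abelian_group T" by (rule abelian_group_tensor)
    show "x \<bullet>\<^bsub>T\<^esub> s \<in> carrier T" if "x \<in> carrier T" "s \<in> carrier S" for x s
      using cl that by blast
    show "(x \<oplus>\<^bsub>T\<^esub> y) \<bullet>\<^bsub>T\<^esub> s = x \<bullet>\<^bsub>T\<^esub> s \<oplus>\<^bsub>T\<^esub> y \<bullet>\<^bsub>T\<^esub> s"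
      if "x \<in> carrier T" "y \<in> carrier T" "s \<in> carrier S" for x y s
      using additive_hom_add[OF tensor_ract_hom] that by blast
    show "x \<bullet>\<^bsub>T\<^esub> (r \<oplus>\<^bsub>S\<^esub> s) = x \<bullet>\<^bsub>T\<^esub> r \<oplus>\<^bsub>T\<^esub> x \<bullet>\<^bsub>T\<^esub> s"
      if "x \<in> carrier T" "r \<in> carrier S" "s \<in> carrier S" for x r s
    proof (rule tensor_hom_eqI[OF abelian_group_tensor _ _ _ that(1)])
      show "(\<lambda>x. x \<bullet>\<^bsub>T\<^esub> (r \<oplus>\<^bsub>S\<^esub> s)) \<in> hom (add_monoid T) (add_monoid T)"
        using that by (intro tensor_ract_hom) simp
      show "(\<lambda>x. x \<bullet>\<^bsub>T\<^esub> r \<oplus>\<^bsub>T\<^esub> x \<bullet>\<^bsub>T\<^esub> s) \<in> hom (add_monoid T) (add_monoid T)"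
        using that by (intro homI)
          (auto simp: cl additive_hom_add[OF tensor_ract_hom] T.add.m_ac)
    qed (use that in \<open>simp add: pure_ract W.add_ract pure_add_right W.ract_closed\<close>)
    show "x \<bullet>\<^bsub>T\<^esub> (r \<otimes>\<^bsub>S\<^esub> s) = x \<bullet>\<^bsub>T\<^esub> r \<bullet>\<^bsub>T\<^esub> s"
      if "x \<in> carrier T" "r \<in> carrier S" "s \<in> carrier S" for x r s
    proof (rule tensor_hom_eqI[OF abelian_group_tensor _ _ _ that(1)])
      show "(\<lambda>x. x \<bullet>\<^bsub>T\<^esub> (r \<otimes>\<^bsub>S\<^esub> s)) \<in> hom (add_monoid T) (add_monoid T)"
        using that by (intro tensor_ract_hom) simp
      show "(\<lambda>x. x \<bullet>\<^bsub>T\<^esub> r \<bullet>\<^bsub>T\<^esub> s) \<in> hom (add_monoid T) (add_monoid T)"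
        using that by (intro homI) (auto simp: cl additive_hom_add[OF tensor_ract_hom])
    qed (use that in \<open>simp add: pure_ract W.ract_mult W.ract_closed\<close>)
    show "x \<bullet>\<^bsub>T\<^esub> \<one>\<^bsub>S\<^esub> = x" if "x \<in> carrier T" for x
    proof (rule tensor_hom_eqI[OF abelian_group_tensor _ _ _ that])
      show "(\<lambda>x. x \<bullet>\<^bsub>T\<^esub> \<one>\<^bsub>S\<^esub>) \<in> hom (add_monoid T) (add_monoid T)"
        by (intro tensor_ract_hom) simp
    qed (auto simp: pure_ract W.ract_one hom_def)
  qed
qed

subsection \<open>Universal property\<close>

definition balanced :: "('x, 'u) rmodule \<Rightarrow> ('m \<Rightarrow> 'n \<Rightarrow> 'u) \<Rightarrow> bool"
  where "balanced U b \<longleftrightarrow>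
    (\<forall>v\<in>carrier V. b v \<in> hom (add_monoid W) (add_monoid U)) \<and>
    (\<forall>w\<in>carrier W. (\<lambda>v. b v w) \<in> hom (add_monoid V) (add_monoid U)) \<and>
    (\<forall>v\<in>carrier V. \<forall>r\<in>carrier R. \<forall>w\<in>carrier W. b (v \<bullet>\<^bsub>V\<^esub> r) w = b v (lact W r w))"

definition free_lift ::
    "('x, 'u) rmodule \<Rightarrow> ('m \<Rightarrow> 'n \<Rightarrow> 'u) \<Rightarrow> (('m \<times> 'n) \<Rightarrow>\<^sub>0 int) \<Rightarrow> 'u"
  where "free_lift U b c =
    (\<Oplus>\<^bsub>U\<^esub>p\<in>Poly_Mapping.keys c. [Poly_Mapping.lookup c p] \<cdot>\<^bsub>U\<^esub> b (fst p) (snd p))"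

context
  fixes U :: "('x, 'u) rmodule" and b
  assumes U: "abelian_group U" and b: "balanced U b"
begin

interpretation U: abelian_group U by (rule U)

lemma balanced_closed: "v \<in> carrier V \<Longrightarrow> w \<in> carrier W \<Longrightarrow> b v w \<in> carrier U"
  using b by (auto simp: balanced_def hom_def)

text \<open>
  Summing over a set larger than the support is harmless and allows two formal combinations with
  different supports to be added under one sum.
\<close>

lemma free_lift_superset:
  assumes "finite A" "Poly_Mapping.keys c \<subseteq> A" "A \<subseteq> carrier V \<times> carrier W"
  shows "free_lift U b c =
    (\<Oplus>\<^bsub>U\<^esub>p\<in>A. [Poly_Mapping.lookup c p] \<cdot>\<^bsub>U\<^esub> b (fst p) (snd p))"
  unfolding free_lift_def
  by (rule U.add.finprod_mono_neutral_cong_left)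
    (use assms in \<open>auto simp: in_keys_iff U.add_int_pow_0 intro!: U.add_int_pow_closed balanced_closed\<close>)

lemma free_lift_hom: "free_lift U b \<in> hom F (add_monoid U)"
proof (rule homI)
  fix c assume "c \<in> carrier F"
  then show "free_lift U b c \<in> carrier (add_monoid U)"
    by (auto simp: free_lift_def carrier_free intro!: U.finsum_closed U.add_int_pow_closed balanced_closed)
next
  fix c d assume cd: "c \<in> carrier F" "d \<in> carrier F"
  let ?A = "Poly_Mapping.keys c \<union> Poly_Mapping.keys d"
  have A: "finite ?A" "?A \<subseteq> carrier V \<times> carrier W"
    using cd by (auto simp: carrier_free)
  then have b': "b (fst p) (snd p) \<in> carrier U" if "p \<in> ?A" for p
    using that by (intro balanced_closed) auto
  have "free_lift U b (c + d) =
      (\<Oplus>\<^bsub>U\<^esub>p\<in>?A. [Poly_Mapping.lookup (c + d) p] \<cdot>\<^bsub>U\<^esub> b (fst p) (snd p))"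
    by (rule free_lift_superset) (use A keys_add[of c d] in auto)
  also have "\<dots> = (\<Oplus>\<^bsub>U\<^esub>p\<in>?A. [Poly_Mapping.lookup c p] \<cdot>\<^bsub>U\<^esub> b (fst p) (snd p) \<oplus>\<^bsub>U\<^esub>
      [Poly_Mapping.lookup d p] \<cdot>\<^bsub>U\<^esub> b (fst p) (snd p))"
    using b' by (intro U.add.finprod_cong') (auto simp: lookup_add U.add_int_pow_add intro: U.add_int_pow_closed)
  also have "\<dots> = (\<Oplus>\<^bsub>U\<^esub>p\<in>?A. [Poly_Mapping.lookup c p] \<cdot>\<^bsub>U\<^esub> b (fst p) (snd p)) \<oplus>\<^bsub>U\<^esub>
      (\<Oplus>\<^bsub>U\<^esub>p\<in>?A. [Poly_Mapping.lookup d p] \<cdot>\<^bsub>U\<^esub> b (fst p) (snd p))"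
    using b' by (intro U.finsum_addf) (auto intro: U.add_int_pow_closed)
  also have "\<dots> = free_lift U b c \<oplus>\<^bsub>U\<^esub> free_lift U b d"
    using A by (simp add: free_lift_superset[of ?A])
  finally show "free_lift U b (c \<otimes>\<^bsub>F\<^esub> d) = free_lift U b c \<otimes>\<^bsub>add_monoid U\<^esub> free_lift U b d"
    by (simp add: mult_free)
qed

lemma free_lift_of:
  "v \<in> carrier V \<Longrightarrow> w \<in> carrier W \<Longrightarrow> free_lift U b (frag_of (v, w)) = b v w"
  by (simp add: free_lift_def balanced_closed U.add_int_pow_1)

lemma free_lift_diff:
  assumes "c \<in> carrier F" "d \<in> carrier F"
  shows "free_lift U b (c - d) = free_lift U b c \<ominus>\<^bsub>U\<^esub> free_lift U b d"
proof -
  have cl: "free_lift U b x \<in> carrier U" if "x \<in> carrier F" for x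
    using free_lift_hom that by (auto simp: hom_def)
  have "free_lift U b c = free_lift U b (c - d) \<oplus>\<^bsub>U\<^esub> free_lift U b d"
    using free_lift_hom diff_free[OF assms] assms(2)
    by (fastforce simp: hom_def mult_free)
  then show ?thesis
    using assms by (simp add: cl diff_free a_minus_def U.a_assoc U.r_neg)
qed

lemma free_lift_relation:
  assumes "c \<in> tensor_relations R V W"
  shows "free_lift U b c = \<zero>\<^bsub>U\<^esub>"
proof -
  from assms consider
    (l) v v' w where "c = frag_of (v \<oplus>\<^bsub>V\<^esub> v', w) - frag_of (v, w) - frag_of (v', w)"
      "v \<in> carrier V" "v' \<in> carrier V" "w \<in> carrier W"
    | (r) v w w' where "c = frag_of (v, w \<oplus>\<^bsub>W\<^esub> w') - frag_of (v, w) - frag_of (v, w')"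
      "v \<in> carrier V" "w \<in> carrier W" "w' \<in> carrier W"
    | (b) v r w where "c = frag_of (v \<bullet>\<^bsub>V\<^esub> r, w) - frag_of (v, lact W r w)"
      "v \<in> carrier V" "r \<in> carrier R" "w \<in> carrier W"
    unfolding tensor_relations_def by blast
  then show ?thesis
  proof cases
    case l
    moreover have "b (v \<oplus>\<^bsub>V\<^esub> v') w = b v w \<oplus>\<^bsub>U\<^esub> b v' w"
      using b l by (auto simp: balanced_def hom_def)
    ultimately show ?thesis
      by (simp add: free_lift_diff diff_free frag_of_free free_lift_of balanced_closed a_minus_def
          U.add.m_ac U.r_neg)
  next
    case r
    moreover have "b v (w \<oplus>\<^bsub>W\<^esub> w') = b v w \<oplus>\<^bsub>U\<^esub> b v w'"
      using b r by (auto simp: balanced_def hom_def)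
    ultimately show ?thesis
      by (simp add: free_lift_diff diff_free frag_of_free free_lift_of balanced_closed a_minus_def
          U.add.m_ac U.r_neg)
  next
    case b
    moreover have "b (v \<bullet>\<^bsub>V\<^esub> r) w = b v (lact W r w)"
      using \<open>balanced U b\<close> b by (auto simp: balanced_def)
    ultimately show ?thesis
      by (simp add: free_lift_diff frag_of_free free_lift_of balanced_closed a_minus_def
          U.r_neg lact_closed V.ract_closed)
  qed
qed

lemma tensor_lift_coset:
  assumes "c \<in> carrier F"
  shows "tensor_lift U b (coset c) = free_lift U b c"
proof -
  have "free_lift U b ` coset c = {free_lift U b c}"
    by (rule hom_image_coset[OF U.a_group free_lift_hom])
      (simp_all add: free_lift_relation assms)
  then show ?thesis
    by (simp add: tensor_lift_def flip: free_lift_def)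
qed

lemma tensor_lift_pure:
  assumes "v \<in> carrier V" "w \<in> carrier W"
  shows "tensor_lift U b (pure v w) = b v w"
  using assms by (simp add: pure_coset tensor_lift_coset frag_of_free free_lift_of)

lemma tensor_lift_hom: "tensor_lift U b \<in> hom (add_monoid T) (add_monoid U)"
proof (rule homI)
  fix x assume "x \<in> carrier (add_monoid T)"
  then show "tensor_lift U b x \<in> carrier (add_monoid U)"
    using free_lift_hom by (auto elim!: tensor_cosetE simp: tensor_lift_coset hom_def)
next
  fix x y assume "x \<in> carrier (add_monoid T)" "y \<in> carrier (add_monoid T)"
  then obtain c d where c: "c \<in> carrier F" "x = coset c" and d: "d \<in> carrier F" "y = coset d"
    by (auto elim!: tensor_cosetE)
  then show "tensor_lift U b (x \<otimes>\<^bsub>add_monoid T\<^esub> y) =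
      tensor_lift U b x \<otimes>\<^bsub>add_monoid U\<^esub> tensor_lift U b y"
    using tensor_lift_coset[OF free_add_closed[of c d]] free_lift_hom
    by (simp add: tensor_lift_coset coset_add hom_def mult_free)
qed

end

lemma tensor_lift_rmodule_hom:
  assumes U: "right_module S U" and b: "balanced U b"
    and ract: "\<And>v w s. v \<in> carrier V \<Longrightarrow> w \<in> carrier W \<Longrightarrow> s \<in> carrier S \<Longrightarrow>
      b v (w \<bullet>\<^bsub>W\<^esub> s) = b v w \<bullet>\<^bsub>U\<^esub> s"
  shows "tensor_lift U b \<in> rmodule_hom S T U"
proof -
  interpret U: right_module S U by (rule U)
  note h = tensor_lift_hom[OF U.V.abelian_group_axioms b]
  have "tensor_lift U b (x \<bullet>\<^bsub>T\<^esub> s) = tensor_lift U b x \<bullet>\<^bsub>U\<^esub> s"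
    if "x \<in> carrier T" "s \<in> carrier S" for x s
  proof (rule tensor_hom_eqI[OF U.V.abelian_group_axioms _ _ _ that(1)])
    show "(\<lambda>x. tensor_lift U b (x \<bullet>\<^bsub>T\<^esub> s)) \<in> hom (add_monoid T) (add_monoid U)"
      using hom_compose[OF tensor_ract_hom[OF that(2)] h] by (simp add: comp_def)
    show "(\<lambda>x. tensor_lift U b x \<bullet>\<^bsub>U\<^esub> s) \<in> hom (add_monoid T) (add_monoid U)"
      using hom_compose[OF h U.ract_hom[OF that(2)]] by (simp add: comp_def)
  qed (use that in \<open>simp add: pure_ract W.ract_closed ract
        tensor_lift_pure[OF U.V.abelian_group_axioms b]\<close>)
  then show ?thesis
    using h by (simp add: rmodule_hom_def)
qed

end

section \<open>Monoid algebras\<close>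

locale finite_monoid = monoid S for S :: "'s monoid" +
  assumes finite_carrier: "finite (carrier S)"

lemma sum_delta_mult:
  fixes F :: "'p \<Rightarrow> 'k::semiring_0"
  assumes "finite P" "q \<in> P"
  shows "(\<Sum>p\<in>P. (if q = p then c else 0) * F p) = c * F q"
proof -
  have "(\<Sum>p\<in>P. (if q = p then c else 0) * F p) = (\<Sum>p\<in>P. if q = p then c * F p else 0)"
    by (intro sum.cong) auto
  also have "\<dots> = c * F q"
    using assms by (simp add: sum.delta')
  finally show ?thesis .
qed

lemma monoid_algebra_simps:
  fixes S :: "'s monoid"
  defines "A \<equiv> monoid_algebra S :: ('s \<Rightarrow> 'k::field) ring"
  shows carrier_monoid_algebra: "carrier A = {f. \<forall>s. s \<notin> carrier S \<longrightarrow> f s = 0}"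
    and add_monoid_algebra: "f \<oplus>\<^bsub>A\<^esub> g = (\<lambda>s. f s + g s)"
    and zero_monoid_algebra: "\<zero>\<^bsub>A\<^esub> = (\<lambda>_. 0)"
    and one_monoid_algebra: "\<one>\<^bsub>A\<^esub> = basis_elt \<one>\<^bsub>S\<^esub>"
    and mult_monoid_algebra: "(f \<otimes>\<^bsub>A\<^esub> g) p =
      (\<Sum>m\<in>carrier S. \<Sum>n\<in>carrier S. if m \<otimes>\<^bsub>S\<^esub> n = p then f m * g n else 0)"
  by (simp_all add: A_def monoid_algebra_def)

context finite_monoid
begin

abbreviation alg :: "('s \<Rightarrow> 'k::field) ring"
  where "alg \<equiv> monoid_algebra S"

lemma mult_alg_closed:
  assumes "f \<in> carrier alg" "g \<in> carrier alg"
  shows "f \<otimes>\<^bsub>alg\<^esub> g \<in> carrier alg"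
  unfolding carrier_monoid_algebra mult_monoid_algebra
  by (auto intro!: sum.neutral)

lemma basis_elt_alg: "s \<in> carrier S \<Longrightarrow> basis_elt s \<in> carrier alg"
  by (auto simp: carrier_monoid_algebra basis_elt_def)

text \<open>
  Pairing the product \<open>f g\<close> with an arbitrary test function \<open>F\<close> expresses that the product is the
  bilinear extension of the one of \<open>S\<close>. Associativity follows by choosing for \<open>F\<close> the coefficient at
  a point of the product with a third element.
\<close>

lemma sum_mult_alg:
  fixes f g :: "'s \<Rightarrow> 'k::field"
  shows "(\<Sum>p\<in>carrier S. (f \<otimes>\<^bsub>alg\<^esub> g) p * F p) =
    (\<Sum>m\<in>carrier S. \<Sum>n\<in>carrier S. f m * g n * F (m \<otimes>\<^bsub>S\<^esub> n))"
proof -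
  have "(\<Sum>p\<in>carrier S. (f \<otimes>\<^bsub>alg\<^esub> g) p * F p) =
      (\<Sum>p\<in>carrier S. \<Sum>m\<in>carrier S. \<Sum>n\<in>carrier S.
        (if m \<otimes>\<^bsub>S\<^esub> n = p then f m * g n else 0) * F p)"
    by (simp add: mult_monoid_algebra sum_distrib_right)
  also have "\<dots> = (\<Sum>m\<in>carrier S. \<Sum>p\<in>carrier S. \<Sum>n\<in>carrier S.
        (if m \<otimes>\<^bsub>S\<^esub> n = p then f m * g n else 0) * F p)"
    by (rule sum.swap)
  also have "\<dots> = (\<Sum>m\<in>carrier S. \<Sum>n\<in>carrier S. \<Sum>p\<in>carrier S.
        (if m \<otimes>\<^bsub>S\<^esub> n = p then f m * g n else 0) * F p)"
    by (intro sum.cong refl sum.swap)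
  also have "\<dots> = (\<Sum>m\<in>carrier S. \<Sum>n\<in>carrier S. f m * g n * F (m \<otimes>\<^bsub>S\<^esub> n))"
    by (intro sum.cong refl sum_delta_mult finite_carrier m_closed)
  finally show ?thesis .
qed

lemma mult_alg_assoc:
  fixes f g h :: "'s \<Rightarrow> 'k::field"
  shows "f \<otimes>\<^bsub>alg\<^esub> g \<otimes>\<^bsub>alg\<^esub> h = f \<otimes>\<^bsub>alg\<^esub> (g \<otimes>\<^bsub>alg\<^esub> h)"
proof
  fix q :: 's
  (* The test function that reads off the coefficient at q. *)
  let ?d = "\<lambda>p. if p = q then 1 else 0 :: 'k"
  have "(f \<otimes>\<^bsub>alg\<^esub> g \<otimes>\<^bsub>alg\<^esub> h) q = (\<Sum>p\<in>carrier S. (f \<otimes>\<^bsub>alg\<^esub> g) p *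
      (\<Sum>k\<in>carrier S. h k * ?d (p \<otimes>\<^bsub>S\<^esub> k)))"
    by (subst mult_monoid_algebra) (auto simp: sum_distrib_left intro!: sum.cong)
  also have "\<dots> = (\<Sum>m\<in>carrier S. \<Sum>n\<in>carrier S. f m * g n *
      (\<Sum>k\<in>carrier S. h k * ?d (m \<otimes>\<^bsub>S\<^esub> n \<otimes>\<^bsub>S\<^esub> k)))"
    by (rule sum_mult_alg)
  also have "\<dots> = (\<Sum>m\<in>carrier S. f m * (\<Sum>n\<in>carrier S. \<Sum>k\<in>carrier S. g n * h k *
      ?d (m \<otimes>\<^bsub>S\<^esub> (n \<otimes>\<^bsub>S\<^esub> k))))"
    by (intro sum.cong refl) (auto simp: sum_distrib_left m_assoc mult.assoc intro!: sum.cong)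
  also have "\<dots> = (\<Sum>m\<in>carrier S. f m * (\<Sum>p\<in>carrier S. (g \<otimes>\<^bsub>alg\<^esub> h) p * ?d (m \<otimes>\<^bsub>S\<^esub> p)))"
    by (subst sum_mult_alg) (rule refl)
  also have "\<dots> = (f \<otimes>\<^bsub>alg\<^esub> (g \<otimes>\<^bsub>alg\<^esub> h)) q"
    by (subst (2) mult_monoid_algebra) (auto simp: sum_distrib_left intro!: sum.cong)
  finally show "(f \<otimes>\<^bsub>alg\<^esub> g \<otimes>\<^bsub>alg\<^esub> h) q = (f \<otimes>\<^bsub>alg\<^esub> (g \<otimes>\<^bsub>alg\<^esub> h)) q" .
qed

lemma one_mult_alg:
  assumes "f \<in> carrier alg"
  shows "basis_elt \<one>\<^bsub>S\<^esub> \<otimes>\<^bsub>alg\<^esub> f = f" and "f \<otimes>\<^bsub>alg\<^esub> basis_elt \<one>\<^bsub>S\<^esub> = f"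
proof -
  have f: "f p = 0" if "p \<notin> carrier S" for p
    using assms that by (simp add: carrier_monoid_algebra)
  have "(basis_elt \<one>\<^bsub>S\<^esub> \<otimes>\<^bsub>alg\<^esub> f) p = f p" for p
  proof -
    have "(basis_elt \<one>\<^bsub>S\<^esub> \<otimes>\<^bsub>alg\<^esub> f) p =
        (\<Sum>m\<in>carrier S. if m = \<one>\<^bsub>S\<^esub> then \<Sum>n\<in>carrier S. if n = p then f n else 0 else 0)"
      unfolding mult_monoid_algebra
      by (rule sum.cong[OF refl]) (auto simp: basis_elt_def intro!: sum.cong sum.neutral)
    also have "\<dots> = f p"
      using f finite_carrier by simp
    finally show ?thesis .
  qed
  then show "basis_elt \<one>\<^bsub>S\<^esub> \<otimes>\<^bsub>alg\<^esub> f = f" ..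
  have "(f \<otimes>\<^bsub>alg\<^esub> basis_elt \<one>\<^bsub>S\<^esub>) p = f p" for p
  proof -
    have "(f \<otimes>\<^bsub>alg\<^esub> basis_elt \<one>\<^bsub>S\<^esub>) p =
        (\<Sum>m\<in>carrier S. \<Sum>n\<in>carrier S. if n = \<one>\<^bsub>S\<^esub> then (if m = p then f m else 0) else 0)"
      unfolding mult_monoid_algebra
      by (intro sum.cong refl) (auto simp: basis_elt_def)
    also have "\<dots> = f p"
      using f finite_carrier by simp
    finally show ?thesis .
  qed
  then show "f \<otimes>\<^bsub>alg\<^esub> basis_elt \<one>\<^bsub>S\<^esub> = f" ..
qed

lemma abelian_group_alg: "abelian_group (alg :: ('s \<Rightarrow> 'k::field) ring)"
proof (rule abelian_groupI)
  fix f :: "'s \<Rightarrow> 'k"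
  assume "f \<in> carrier alg"
  then show "\<exists>g\<in>carrier alg. g \<oplus>\<^bsub>alg\<^esub> f = \<zero>\<^bsub>alg\<^esub>"
    by (intro bexI[of _ "\<lambda>s. - f s"])
      (auto simp: carrier_monoid_algebra add_monoid_algebra zero_monoid_algebra)
qed (auto simp: carrier_monoid_algebra add_monoid_algebra zero_monoid_algebra algebra_simps)

lemma ring_alg: "ring (alg :: ('s \<Rightarrow> 'k::field) ring)"
proof (intro ringI abelian_group_alg monoidI)
  show "\<one>\<^bsub>alg\<^esub> \<in> carrier alg"
    by (simp add: one_monoid_algebra basis_elt_alg)
  fix f g h :: "'s \<Rightarrow> 'k::field"
  show "f \<otimes>\<^bsub>alg\<^esub> g \<otimes>\<^bsub>alg\<^esub> h = f \<otimes>\<^bsub>alg\<^esub> (g \<otimes>\<^bsub>alg\<^esub> h)"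
    by (rule mult_alg_assoc)
  show "(f \<oplus>\<^bsub>alg\<^esub> g) \<otimes>\<^bsub>alg\<^esub> h = f \<otimes>\<^bsub>alg\<^esub> h \<oplus>\<^bsub>alg\<^esub> g \<otimes>\<^bsub>alg\<^esub> h"
    unfolding add_monoid_algebra
    by (rule ext, unfold mult_monoid_algebra sum.distrib[symmetric], intro sum.cong refl)
      (simp add: distrib_right)
  show "h \<otimes>\<^bsub>alg\<^esub> (f \<oplus>\<^bsub>alg\<^esub> g) = h \<otimes>\<^bsub>alg\<^esub> f \<oplus>\<^bsub>alg\<^esub> h \<otimes>\<^bsub>alg\<^esub> g"
    unfolding add_monoid_algebra
    by (rule ext, unfold mult_monoid_algebra sum.distrib[symmetric], intro sum.cong refl)
      (simp add: distrib_left)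
qed (auto simp: one_monoid_algebra one_mult_alg mult_alg_closed)

lemma basis_elt_mult:
  assumes "s \<in> carrier S" "t \<in> carrier S"
  shows "basis_elt s \<otimes>\<^bsub>alg\<^esub> basis_elt t = (basis_elt (s \<otimes>\<^bsub>S\<^esub> t) :: 's \<Rightarrow> 'k::field)"
proof
  fix p
  have "(basis_elt s \<otimes>\<^bsub>alg\<^esub> basis_elt t) p = (\<Sum>m\<in>carrier S. if m = s then
      (\<Sum>n\<in>carrier S. if n = t then (if s \<otimes>\<^bsub>S\<^esub> n = p then 1 else 0) else 0) else 0 :: 'k)"
    unfolding mult_monoid_algebra
    by (rule sum.cong[OF refl]) (auto simp: basis_elt_def intro!: sum.cong sum.neutral)
  also have "\<dots> = basis_elt (s \<otimes>\<^bsub>S\<^esub> t) p"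
    using assms finite_carrier by (auto simp: basis_elt_def)
  finally show "(basis_elt s \<otimes>\<^bsub>alg\<^esub> basis_elt t) p = (basis_elt (s \<otimes>\<^bsub>S\<^esub> t) p :: 'k)" .
qed

lemma mult_alg_nonzeroE:
  assumes "(f \<otimes>\<^bsub>alg\<^esub> g) p \<noteq> 0"
  obtains m n where "m \<in> carrier S" "n \<in> carrier S" "p = m \<otimes>\<^bsub>S\<^esub> n" "f m \<noteq> 0" "g n \<noteq> 0"
proof -
  obtain m where m: "m \<in> carrier S"
    "(\<Sum>n\<in>carrier S. if m \<otimes>\<^bsub>S\<^esub> n = p then f m * g n else 0) \<noteq> 0"
    using assms unfolding mult_monoid_algebra by (rule sum.not_neutral_contains_not_neutral)
  from m(2) obtain n where "n \<in> carrier S" "(if m \<otimes>\<^bsub>S\<^esub> n = p then f m * g n else 0) \<noteq> 0"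
    by (rule sum.not_neutral_contains_not_neutral)
  then show ?thesis
    using that[of m n] m(1) by (auto split: if_splits)
qed

end

section \<open>The minimal ideal\<close>

lemma (in monoid) ideal_inter:
  assumes "monoid_ideal G I" "monoid_ideal G J"
  shows "monoid_ideal G (I \<inter> J)"
proof -
  obtain x y where "x \<in> I" "y \<in> J"
    using assms by (auto simp: monoid_ideal_def)
  then have "x \<otimes> y \<in> I \<inter> J"
    using assms by (auto simp: monoid_ideal_def)
  then show ?thesis
    using assms by (auto simp: monoid_ideal_def)
qed

text \<open>
  Finiteness yields a minimal ideal; two minimal ideals contain their intersection, which is
  nonempty because it contains their product, hence an ideal, and so they coincide.
\<close>

lemma (in finite_monoid) minimal_ideal:
  shows ideal_minimal_ideal: "monoid_ideal S (minimal_ideal S)"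
    and minimal_ideal_minimal:
      "\<And>J. monoid_ideal S J \<Longrightarrow> J \<subseteq> minimal_ideal S \<Longrightarrow> J = minimal_ideal S"
proof -
  let ?P = "\<lambda>I. monoid_ideal S I \<and> (\<forall>J. monoid_ideal S J \<and> J \<subseteq> I \<longrightarrow> J = I)"
  have "{I. monoid_ideal S I} \<subseteq> Pow (carrier S)"
    by (auto simp: monoid_ideal_def)
  then have "finite {I. monoid_ideal S I}"
    using finite_carrier by (meson finite_Pow_iff finite_subset)
  moreover have "monoid_ideal S (carrier S)"
    by (auto simp: monoid_ideal_def)
  ultimately obtain I where "I \<in> {I. monoid_ideal S I}"
      "\<forall>J\<in>{I. monoid_ideal S I}. J \<subseteq> I \<longrightarrow> I = J"
    using finite_has_minimal[of "{I. monoid_ideal S I}"] by blast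
  then have "?P I" by auto
  moreover have "J = I" if "?P J" for J
    using ideal_inter[of I J] \<open>?P I\<close> that by (metis inf_le1 inf_le2)
  ultimately have "?P (minimal_ideal S)"
    unfolding minimal_ideal_def by (rule theI)
  then show "monoid_ideal S (minimal_ideal S)"
    "\<And>J. monoid_ideal S J \<Longrightarrow> J \<subseteq> minimal_ideal S \<Longrightarrow> J = minimal_ideal S"
    by auto
qed

section \<open>The local group\<close>

locale finite_monoid_idempotent = finite_monoid S for S :: "'s monoid" +
  fixes e
  assumes e_closed: "e \<in> carrier S" and e_idem: "e \<otimes>\<^bsub>S\<^esub> e = e"
begin

abbreviation (input) eSe where "eSe \<equiv> local_monoid S e"
abbreviation (input) Ge where "Ge \<equiv> local_group S e"

text \<open>
  The elements of \<open>eSe\<close> are described by the equations \<open>ex = x = xe\<close>, which avoids existential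
  quantifiers in the sequel.
\<close>

lemma local_monoid_simps:
  "carrier eSe = {x \<in> carrier S. e \<otimes>\<^bsub>S\<^esub> x = x \<and> x \<otimes>\<^bsub>S\<^esub> e = x}"
  "x \<otimes>\<^bsub>eSe\<^esub> y = x \<otimes>\<^bsub>S\<^esub> y" "\<one>\<^bsub>eSe\<^esub> = e"
proof -
  have "e \<otimes>\<^bsub>S\<^esub> (e \<otimes>\<^bsub>S\<^esub> m \<otimes>\<^bsub>S\<^esub> e) = e \<otimes>\<^bsub>S\<^esub> m \<otimes>\<^bsub>S\<^esub> e"
    "e \<otimes>\<^bsub>S\<^esub> m \<otimes>\<^bsub>S\<^esub> e \<otimes>\<^bsub>S\<^esub> e = e \<otimes>\<^bsub>S\<^esub> m \<otimes>\<^bsub>S\<^esub> e" if "m \<in> carrier S" for m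
    using that e_closed e_idem by (simp_all add: m_assoc) (simp_all flip: m_assoc)
  then show "carrier eSe = {x \<in> carrier S. e \<otimes>\<^bsub>S\<^esub> x = x \<and> x \<otimes>\<^bsub>S\<^esub> e = x}"
    using e_closed by (auto simp: local_monoid_def) force
qed (simp_all add: local_monoid_def)

lemma monoid_local_monoid: "monoid eSe"
proof (rule monoidI)
  show "x \<otimes>\<^bsub>eSe\<^esub> y \<in> carrier eSe" if "x \<in> carrier eSe" "y \<in> carrier eSe" for x y
    using that e_closed by (auto simp: local_monoid_simps simp flip: m_assoc) (auto simp: m_assoc)
qed (auto simp: local_monoid_simps e_closed e_idem m_assoc)

lemma group_local_group: "group Ge"
  unfolding local_group_def by (rule monoid.units_group[OF monoid_local_monoid])

lemma local_group_mult: "x \<otimes>\<^bsub>Ge\<^esub> y = x \<otimes>\<^bsub>S\<^esub> y"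
  by (simp add: local_group_def units_of_def local_monoid_simps)

lemma local_group_one: "\<one>\<^bsub>Ge\<^esub> = e"
  by (simp add: local_group_def units_of_def local_monoid_simps)

lemma local_group_memD:
  assumes "x \<in> carrier Ge"
  shows "x \<in> carrier S" "e \<otimes>\<^bsub>S\<^esub> x = x" "x \<otimes>\<^bsub>S\<^esub> e = x"
  using assms by (auto simp: local_group_def units_of_def Units_def local_monoid_simps)

lemma finite_monoid_local_group: "finite_monoid Ge"
proof -
  have "finite (carrier Ge)"
    by (rule finite_subset[OF _ finite_carrier]) (auto dest: local_group_memD)
  then show ?thesis
    using group_local_group by (simp add: finite_monoid_def finite_monoid_axioms_def group_def)
qed

text \<open>
  The ideal generated by \<open>y = eme\<close> lies in the minimal ideal and therefore contains \<open>e\<close>, say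
  \<open>e = ayb\<close>. Sandwiching by \<open>e\<close> gives \<open>xyz = e\<close> with \<open>x = eae\<close>, \<open>z = ebe\<close> in \<open>eSe\<close>. In a finite
  monoid one-sided inverses are two-sided, so \<open>z\<close> and \<open>yz\<close>, hence \<open>y\<close>, are units.
\<close>

lemma local_group_minimal_ideal:
  assumes e: "e \<in> minimal_ideal S" and m: "m \<in> carrier S"
  shows "e \<otimes>\<^bsub>S\<^esub> m \<otimes>\<^bsub>S\<^esub> e \<in> carrier Ge"
proof -
  interpret L: monoid eSe by (rule monoid_local_monoid)
  define y where "y = e \<otimes>\<^bsub>S\<^esub> m \<otimes>\<^bsub>S\<^esub> e"
  have y: "y \<in> carrier eSe"
    using m by (auto simp: local_monoid_def y_def)
  then have yS: "y \<in> carrier S"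
    by (simp add: local_monoid_simps)
  define J where "J = {a \<otimes>\<^bsub>S\<^esub> y \<otimes>\<^bsub>S\<^esub> b |a b. a \<in> carrier S \<and> b \<in> carrier S}"
  have "monoid_ideal S J"
    unfolding monoid_ideal_def
  proof (intro conjI ballI)
    show "J \<subseteq> carrier S" "J \<noteq> {}"
      using yS by (auto simp: J_def)
    fix x s assume "x \<in> J" and s: "s \<in> carrier S"
    then obtain a b where ab: "a \<in> carrier S" "b \<in> carrier S" "x = a \<otimes>\<^bsub>S\<^esub> y \<otimes>\<^bsub>S\<^esub> b"
      by (auto simp: J_def)
    have "x \<otimes>\<^bsub>S\<^esub> s = a \<otimes>\<^bsub>S\<^esub> y \<otimes>\<^bsub>S\<^esub> (b \<otimes>\<^bsub>S\<^esub> s)" "s \<otimes>\<^bsub>S\<^esub> x = (s \<otimes>\<^bsub>S\<^esub> a) \<otimes>\<^bsub>S\<^esub> y \<otimes>\<^bsub>S\<^esub> b"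
      using ab s yS by (simp_all add: m_assoc)
    then show "x \<otimes>\<^bsub>S\<^esub> s \<in> J" "s \<otimes>\<^bsub>S\<^esub> x \<in> J"
      using ab s unfolding J_def by blast+
  qed
  moreover have "J \<subseteq> minimal_ideal S"
    using ideal_minimal_ideal e m e_closed
    by (auto simp: J_def monoid_ideal_def y_def)
  ultimately have "J = minimal_ideal S"
    by (rule minimal_ideal_minimal)
  with e have "e \<in> J" by simp
  then obtain a b where ab: "a \<in> carrier S" "b \<in> carrier S" "e = a \<otimes>\<^bsub>S\<^esub> y \<otimes>\<^bsub>S\<^esub> b"
    unfolding J_def by blast
  define x z where "x = e \<otimes>\<^bsub>S\<^esub> a \<otimes>\<^bsub>S\<^esub> e" and "z = e \<otimes>\<^bsub>S\<^esub> b \<otimes>\<^bsub>S\<^esub> e"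
  have xz: "x \<in> carrier eSe" "z \<in> carrier eSe"
    using ab by (auto simp: local_monoid_def x_def z_def)
  have ey: "e \<otimes>\<^bsub>S\<^esub> y = y" "y \<otimes>\<^bsub>S\<^esub> e = y"
    using y by (auto simp: local_monoid_simps)
  have "x \<otimes>\<^bsub>S\<^esub> y \<otimes>\<^bsub>S\<^esub> z = e \<otimes>\<^bsub>S\<^esub> a \<otimes>\<^bsub>S\<^esub> (e \<otimes>\<^bsub>S\<^esub> y \<otimes>\<^bsub>S\<^esub> e) \<otimes>\<^bsub>S\<^esub> b \<otimes>\<^bsub>S\<^esub> e"
    using ab yS e_closed by (simp add: x_def z_def m_assoc)
  also have "\<dots> = e \<otimes>\<^bsub>S\<^esub> (a \<otimes>\<^bsub>S\<^esub> y \<otimes>\<^bsub>S\<^esub> b) \<otimes>\<^bsub>S\<^esub> e"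
    using ab(1,2) yS e_closed by (simp add: ey m_assoc)
  also have "\<dots> = e"
    using ab(3) e_idem by simp
  finally have xyz: "x \<otimes>\<^bsub>eSe\<^esub> y \<otimes>\<^bsub>eSe\<^esub> z = \<one>\<^bsub>eSe\<^esub>"
    by (simp only: local_monoid_simps)
  then have xyz': "x \<otimes>\<^bsub>eSe\<^esub> (y \<otimes>\<^bsub>eSe\<^esub> z) = \<one>\<^bsub>eSe\<^esub>"
    using L.m_assoc[of x y z] xz y by simp
  have fin: "finite (carrier eSe)"
    by (rule finite_subset[OF _ finite_carrier]) (auto simp: local_monoid_simps)
  (* Left multiplication by v is injective on a finite set, hence attains the identity. *)
  have onesided: "u \<in> Units eSe \<and> v \<in> Units eSe"
    if "u \<in> carrier eSe" "v \<in> carrier eSe" "u \<otimes>\<^bsub>eSe\<^esub> v = \<one>\<^bsub>eSe\<^esub>" for u v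
  proof -
    have "inj_on (\<lambda>w. v \<otimes>\<^bsub>eSe\<^esub> w) (carrier eSe)"
      using that by (intro inj_onI) (metis L.l_one L.m_assoc)
    then have "(\<lambda>w. v \<otimes>\<^bsub>eSe\<^esub> w) ` carrier eSe = carrier eSe"
      using fin that by (intro endo_inj_surj) auto
    then obtain w where w: "w \<in> carrier eSe" "v \<otimes>\<^bsub>eSe\<^esub> w = \<one>\<^bsub>eSe\<^esub>"
      using L.one_closed by (metis (no_types, lifting) imageE)
    then have "w = u"
      using that by (metis L.l_one L.m_assoc L.r_one)
    with that w show ?thesis
      by (auto simp: Units_def)
  qed
  have "y \<otimes>\<^bsub>eSe\<^esub> z \<in> Units eSe" "z \<in> Units eSe"
    using onesided[of x "y \<otimes>\<^bsub>eSe\<^esub> z"] onesided[of "x \<otimes>\<^bsub>eSe\<^esub> y" z] xyz xyz' xz y by auto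
  then have "y \<otimes>\<^bsub>eSe\<^esub> z \<otimes>\<^bsub>eSe\<^esub> inv\<^bsub>eSe\<^esub> z \<in> Units eSe"
    by (intro L.Units_m_closed[of "y \<otimes>\<^bsub>eSe\<^esub> z"] L.Units_inv_Units)
  moreover have "y \<otimes>\<^bsub>eSe\<^esub> z \<otimes>\<^bsub>eSe\<^esub> inv\<^bsub>eSe\<^esub> z = y"
    using \<open>z \<in> Units eSe\<close> xz y
    by (simp only: L.m_assoc L.Units_r_inv L.Units_inv_closed L.r_one)
  ultimately have "y \<in> Units eSe" by simp
  then show ?thesis
    by (simp add: y_def local_group_def units_of_def)
qed

subsection \<open>The group algebra inside the monoid algebra\<close>

lemma local_alg_mem:
  assumes "r \<in> carrier (monoid_algebra Ge)"
  shows "r \<in> carrier alg"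
  using assms by (auto simp: carrier_monoid_algebra dest: local_group_memD)

text \<open>
  Coefficients off the local group vanish, so the multiplication of \<open>KG\<^sub>e\<close> is the restriction of that of
  \<open>KS\<close>, although the two are given by sums over different index sets.
\<close>

lemma local_alg_mult:
  fixes f g :: "'s \<Rightarrow> 'k::field"
  assumes f: "f \<in> carrier (monoid_algebra Ge)" and g: "g \<in> carrier (monoid_algebra Ge)"
  shows "f \<otimes>\<^bsub>monoid_algebra Ge\<^esub> g = f \<otimes>\<^bsub>alg\<^esub> g"
proof
  fix p
  have sub: "carrier Ge \<subseteq> carrier S" by (auto dest: local_group_memD)
  have "(f \<otimes>\<^bsub>alg\<^esub> g) p =
      (\<Sum>m\<in>carrier Ge. \<Sum>n\<in>carrier S. if m \<otimes>\<^bsub>S\<^esub> n = p then f m * g n else 0)"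
    unfolding mult_monoid_algebra
    by (rule sum.mono_neutral_right)
      (use f sub finite_carrier in \<open>auto simp: carrier_monoid_algebra intro!: sum.neutral\<close>)
  also have "\<dots> = (\<Sum>m\<in>carrier Ge. \<Sum>n\<in>carrier Ge. if m \<otimes>\<^bsub>S\<^esub> n = p then f m * g n else 0)"
    by (intro sum.cong refl sum.mono_neutral_right)
      (use g sub finite_carrier in \<open>auto simp: carrier_monoid_algebra\<close>)
  finally show "(f \<otimes>\<^bsub>monoid_algebra Ge\<^esub> g) p = (f \<otimes>\<^bsub>alg\<^esub> g) p"
    by (simp add: mult_monoid_algebra local_group_mult)
qed

lemma ring_local_alg: "ring (monoid_algebra Ge)"
  by (rule finite_monoid.ring_alg[OF finite_monoid_local_group])

lemma idem_local_alg: "basis_elt e \<in> carrier (monoid_algebra Ge)"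
  using finite_monoid.basis_elt_alg[OF finite_monoid_local_group]
    monoid.one_closed[OF finite_monoid.axioms(1)[OF finite_monoid_local_group]]
  by (simp add: local_group_one)

lemma idem_mult_local_alg:
  assumes "r \<in> carrier (monoid_algebra Ge)"
  shows "basis_elt e \<otimes>\<^bsub>alg\<^esub> r = r" "r \<otimes>\<^bsub>alg\<^esub> basis_elt e = r"
  using finite_monoid.one_mult_alg[OF finite_monoid_local_group assms] assms
  by (simp_all add: local_group_one local_alg_mult idem_local_alg)

lemma idem_alg: "basis_elt e \<in> carrier alg"
  by (rule basis_elt_alg[OF e_closed])

lemma idem_idem: "basis_elt e \<otimes>\<^bsub>alg\<^esub> basis_elt e = basis_elt e"
  by (simp add: basis_elt_mult e_closed e_idem)

end

section \<open>Induced modules\<close>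

text \<open>
  The induced module and its natural map are studied for an arbitrary right module \<open>U\<close> over the monoid
  algebra; the transformation module enters through its basis, in the dual basis and in surjectivity.
\<close>

locale local_module =
  finite_monoid_idempotent S e + U: right_module "monoid_algebra S" U
  for S :: "'s monoid" and e and U :: "('s \<Rightarrow> 'k::field, 'm) rmodule"
begin

abbreviation (input) KM :: "('s \<Rightarrow> 'k) ring" where "KM \<equiv> monoid_algebra S"
abbreviation (input) KG :: "('s \<Rightarrow> 'k) ring" where "KG \<equiv> monoid_algebra (local_group S e)"
abbreviation (input) eb :: "'s \<Rightarrow> 'k" where "eb \<equiv> basis_elt e"
abbreviation (input) Ue where "Ue \<equiv> times_idem U e"
abbreviation (input) eKM :: "('s \<Rightarrow> 'k, 's \<Rightarrow> 'k, 's \<Rightarrow> 'k) bimodule"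
  where "eKM \<equiv> idem_bimodule S e"

lemma times_idem_simps:
  "v \<oplus>\<^bsub>Ue\<^esub> w = v \<oplus>\<^bsub>U\<^esub> w" "\<zero>\<^bsub>Ue\<^esub> = \<zero>\<^bsub>U\<^esub>" "v \<bullet>\<^bsub>Ue\<^esub> r = v \<bullet>\<^bsub>U\<^esub> r"
  by (simp_all add: times_idem_def)

lemma carrier_times_idem: "v \<in> carrier Ue \<longleftrightarrow> v \<in> carrier U \<and> v \<bullet>\<^bsub>U\<^esub> eb = v"
proof -
  have "u \<bullet>\<^bsub>U\<^esub> eb \<bullet>\<^bsub>U\<^esub> eb = u \<bullet>\<^bsub>U\<^esub> eb" if "u \<in> carrier U" for u
    using that U.ract_mult[OF that idem_alg idem_alg] by (simp add: idem_idem)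
  then show ?thesis
    by (auto simp: times_idem_def U.ract_closed idem_alg) force
qed

lemma abelian_group_times_idem: "abelian_group Ue"
proof -
  have "additive_subgroup {v \<bullet>\<^bsub>U\<^esub> eb |v. v \<in> carrier U} U"
    using additive_subgroup_image[OF U.V.abelian_group_axioms U.V.abelian_group_axioms
        U.ract_hom[OF idem_alg]]
    by (simp add: image_def Bex_def Collect_conv_if2 conj_commute eq_commute)
  then show ?thesis
    unfolding times_idem_def by (rule abelian_group_restrict[OF U.V.abelian_group_axioms])
qed

lemma right_module_times_idem: "right_module KG Ue"
proof (intro right_module.intro right_module_axioms.intro ring_local_alg abelian_group_times_idem)
  fix v w r s
  assume v: "v \<in> carrier Ue" and r: "r \<in> carrier KG"
  then have v': "v \<in> carrier U" and r': "r \<in> carrier KM"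
    by (auto simp: carrier_times_idem local_alg_mem)
  have "v \<bullet>\<^bsub>U\<^esub> r \<bullet>\<^bsub>U\<^esub> eb = v \<bullet>\<^bsub>U\<^esub> r"
    using U.ract_mult[OF v' r' idem_alg] by (simp add: idem_mult_local_alg r)
  then show "v \<bullet>\<^bsub>Ue\<^esub> r \<in> carrier Ue"
    using v' r' by (simp add: carrier_times_idem U.ract_closed times_idem_simps)
  show "(v \<oplus>\<^bsub>Ue\<^esub> w) \<bullet>\<^bsub>Ue\<^esub> r = v \<bullet>\<^bsub>Ue\<^esub> r \<oplus>\<^bsub>Ue\<^esub> w \<bullet>\<^bsub>Ue\<^esub> r" if "w \<in> carrier Ue"
    using that v' r' by (simp add: carrier_times_idem times_idem_simps U.ract_add)
  assume s: "s \<in> carrier KG"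
  then have s': "s \<in> carrier KM"
    by (rule local_alg_mem)
  show "v \<bullet>\<^bsub>Ue\<^esub> (r \<oplus>\<^bsub>KG\<^esub> s) = v \<bullet>\<^bsub>Ue\<^esub> r \<oplus>\<^bsub>Ue\<^esub> v \<bullet>\<^bsub>Ue\<^esub> s"
    using U.add_ract[OF v' r' s'] by (simp add: times_idem_simps add_monoid_algebra)
  show "v \<bullet>\<^bsub>Ue\<^esub> (r \<otimes>\<^bsub>KG\<^esub> s) = v \<bullet>\<^bsub>Ue\<^esub> r \<bullet>\<^bsub>Ue\<^esub> s"
    using U.ract_mult[OF v' r' s'] by (simp add: times_idem_simps local_alg_mult r s)
qed (auto simp: one_monoid_algebra local_group_one carrier_times_idem times_idem_simps)

lemma idem_bimodule_simps:
  "a \<oplus>\<^bsub>eKM\<^esub> b = a \<oplus>\<^bsub>KM\<^esub> b" "\<zero>\<^bsub>eKM\<^esub> = \<zero>\<^bsub>KM\<^esub>" "a \<bullet>\<^bsub>eKM\<^esub> b = a \<otimes>\<^bsub>KM\<^esub> b"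
  "lact eKM a b = a \<otimes>\<^bsub>KM\<^esub> b"
  by (simp_all add: idem_bimodule_def Let_def)

lemma carrier_idem_bimodule: "a \<in> carrier eKM \<longleftrightarrow> a \<in> carrier KM \<and> eb \<otimes>\<^bsub>KM\<^esub> a = a"
proof -
  have "eb \<otimes>\<^bsub>KM\<^esub> (eb \<otimes>\<^bsub>KM\<^esub> b) = eb \<otimes>\<^bsub>KM\<^esub> b" if "b \<in> carrier KM" for b
    using that by (simp add: idem_alg idem_idem flip: U.R.m_assoc)
  then show ?thesis
    by (auto simp: idem_bimodule_def Let_def idem_alg) force
qed

lemma idem_in_bimodule: "eb \<in> carrier eKM"
  by (simp add: carrier_idem_bimodule idem_alg idem_idem)

lemma right_module_idem_bimodule: "right_module KM eKM"
proof (intro right_module.intro right_module_axioms.intro ring_alg)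
  show "abelian_group eKM"
  proof (rule abelian_groupI)
    fix a assume "a \<in> carrier eKM"
    then show "\<exists>b\<in>carrier eKM. b \<oplus>\<^bsub>eKM\<^esub> a = \<zero>\<^bsub>eKM\<^esub>"
      by (intro bexI[of _ "\<ominus>\<^bsub>KM\<^esub> a"])
        (auto simp: carrier_idem_bimodule idem_bimodule_simps U.R.l_neg U.R.r_minus idem_alg)
  qed (auto simp: carrier_idem_bimodule idem_bimodule_simps U.R.r_distr idem_alg U.R.a_ac)
qed (auto simp: carrier_idem_bimodule idem_bimodule_simps U.R.r_distr U.R.l_distr idem_alg U.R.m_assoc
    U.R.a_ac simp flip: U.R.m_assoc[OF idem_alg])

sublocale tensor_product KG KM Ue eKM
proof (intro tensor_product.intro tensor_product_axioms.intro right_module_times_idem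
    right_module_idem_bimodule)
  fix r w s assume r: "r \<in> carrier KG" and w: "w \<in> carrier eKM"
  have "eb \<otimes>\<^bsub>KM\<^esub> (r \<otimes>\<^bsub>KM\<^esub> w) = r \<otimes>\<^bsub>KM\<^esub> w"
    using r w by (simp add: idem_mult_local_alg carrier_idem_bimodule local_alg_mem idem_alg
        flip: U.R.m_assoc)
  then show "lact eKM r w \<in> carrier eKM"
    using r w by (simp add: carrier_idem_bimodule idem_bimodule_simps local_alg_mem)
  show "lact eKM r (w \<bullet>\<^bsub>eKM\<^esub> s) = lact eKM r w \<bullet>\<^bsub>eKM\<^esub> s" if "s \<in> carrier KM"
    using r w that by (simp add: carrier_idem_bimodule idem_bimodule_simps local_alg_mem U.R.m_assoc)
qed

lemma Ind_eq: "Ind S e Ue = tensor KG Ue eKM"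
  by (simp add: Ind_def)

lemma Ind_tensor_eq: "Ind_tensor S e Ue = pure_tensor KG Ue eKM"
  by (simp add: Ind_tensor_def)

lemma balanced_natural: "balanced U (ract U)"
  unfolding balanced_def
proof (intro conjI ballI)
  show "(\<bullet>\<^bsub>U\<^esub>) v \<in> hom (add_monoid eKM) (add_monoid U)" if "v \<in> carrier Ue" for v
    using that by (auto simp: hom_def carrier_times_idem carrier_idem_bimodule U.ract_closed
        idem_bimodule_simps U.add_ract)
  show "(\<lambda>v. v \<bullet>\<^bsub>U\<^esub> a) \<in> hom (add_monoid Ue) (add_monoid U)" if "a \<in> carrier eKM" for a
    using that by (auto simp: hom_def carrier_times_idem carrier_idem_bimodule U.ract_closed
        times_idem_simps U.ract_add)
  show "v \<bullet>\<^bsub>Ue\<^esub> r \<bullet>\<^bsub>U\<^esub> a = v \<bullet>\<^bsub>U\<^esub> lact eKM r a"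
    if "v \<in> carrier Ue" "r \<in> carrier KG" "a \<in> carrier eKM" for v r a
    using that by (simp add: carrier_times_idem carrier_idem_bimodule times_idem_simps
        idem_bimodule_simps U.ract_mult local_alg_mem)
qed

lemma natural_pure:
  "v \<in> carrier Ue \<Longrightarrow> a \<in> carrier eKM \<Longrightarrow> Ind_natural U (pure_tensor KG Ue eKM v a) = v \<bullet>\<^bsub>U\<^esub> a"
  unfolding Ind_natural_def
  by (rule tensor_lift_pure[OF U.V.abelian_group_axioms balanced_natural])

lemma natural_rmodule_hom: "Ind_natural U \<in> rmodule_hom KM (tensor KG Ue eKM) U"
  unfolding Ind_natural_def
  by (rule tensor_lift_rmodule_hom[OF U.right_module_axioms balanced_natural])
    (simp add: carrier_times_idem carrier_idem_bimodule idem_bimodule_simps U.ract_mult)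

lemma natural_hom: "Ind_natural U \<in> hom (add_monoid (tensor KG Ue eKM)) (add_monoid U)"
  using natural_rmodule_hom by (simp add: rmodule_hom_def)

lemma natural_ract:
  "x \<in> carrier (tensor KG Ue eKM) \<Longrightarrow> r \<in> carrier KM \<Longrightarrow>
    Ind_natural U (x \<bullet>\<^bsub>tensor KG Ue eKM\<^esub> r) = Ind_natural U x \<bullet>\<^bsub>U\<^esub> r"
  using natural_rmodule_hom by (simp add: rmodule_hom_def)

lemma pure_left_hom:
  "a \<in> carrier eKM \<Longrightarrow>
    (\<lambda>v. pure_tensor KG Ue eKM v a) \<in> hom (add_monoid Ue) (add_monoid (tensor KG Ue eKM))"
  by (auto simp: hom_def pure_closed pure_add_left)

subsection \<open>The kernel of the natural map\<close>

context
  assumes sandwich: "\<And>m. m \<in> carrier S \<Longrightarrow> e \<otimes>\<^bsub>S\<^esub> m \<otimes>\<^bsub>S\<^esub> e \<in> carrier (local_group S e)"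
begin

text \<open>
  Here \<open>eSe = G\<^sub>e\<close> is used: the support of \<open>a e\<close> with \<open>a \<in> eKS\<close> lies in \<open>eSe\<close>.
\<close>

lemma idem_bimodule_mult_idem:
  assumes "a \<in> carrier eKM"
  shows "a \<otimes>\<^bsub>KM\<^esub> eb \<in> carrier KG"
proof -
  have a: "a = eb \<otimes>\<^bsub>KM\<^esub> a"
    using assms by (simp add: carrier_idem_bimodule)
  have "p \<in> carrier (local_group S e)" if "(a \<otimes>\<^bsub>KM\<^esub> eb) p \<noteq> 0" for p
  proof -
    from that obtain m n where m: "m \<in> carrier S" "p = m \<otimes>\<^bsub>S\<^esub> n" "a m \<noteq> 0" "eb n \<noteq> 0"
      by (rule mult_alg_nonzeroE)
    from m(3) have "(eb \<otimes>\<^bsub>KM\<^esub> a) m \<noteq> 0"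
      using a by simp
    then obtain k l where "l \<in> carrier S" "m = k \<otimes>\<^bsub>S\<^esub> l" "eb k \<noteq> 0"
      by (rule mult_alg_nonzeroE)
    with m sandwich show ?thesis
      by (auto simp: basis_elt_def split: if_splits)
  qed
  then show ?thesis
    by (auto simp: carrier_monoid_algebra)
qed

text \<open>
  On a pure tensor, \<open>(v \<otimes> a)e = v \<otimes> (ae)e\<close>, and \<open>ae \<in> KG\<^sub>e\<close> may be moved to the left factor, giving
  \<open>vae \<otimes> e\<close>. Hence multiplication by \<open>e\<close> factors through the natural map.
\<close>

lemma Ind_ract_idem:
  assumes x: "x \<in> carrier (tensor KG Ue eKM)"
  shows "x \<bullet>\<^bsub>tensor KG Ue eKM\<^esub> eb = pure_tensor KG Ue eKM (Ind_natural U x \<bullet>\<^bsub>U\<^esub> eb) eb"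
proof (rule tensor_hom_eqI[OF abelian_group_tensor _ _ _ x])
  let ?T = "tensor KG Ue eKM"
  show "(\<lambda>x. x \<bullet>\<^bsub>?T\<^esub> eb) \<in> hom (add_monoid ?T) (add_monoid ?T)"
    by (rule tensor_ract_hom[OF idem_alg])
  have "(\<lambda>u. u \<bullet>\<^bsub>U\<^esub> eb) \<in> hom (add_monoid U) (add_monoid Ue)"
    using U.ract_mult[OF _ idem_alg idem_alg]
    by (auto simp: hom_def carrier_times_idem U.ract_closed idem_alg U.ract_add times_idem_simps
        idem_idem)
  from hom_compose[OF hom_compose[OF natural_hom this] pure_left_hom[OF idem_in_bimodule]]
  show "(\<lambda>x. pure_tensor KG Ue eKM (Ind_natural U x \<bullet>\<^bsub>U\<^esub> eb) eb) \<in> hom (add_monoid ?T) (add_monoid ?T)"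
    by (simp add: comp_def)
  fix v a assume v: "v \<in> carrier Ue" and a: "a \<in> carrier eKM"
  then have v': "v \<in> carrier U" and a': "a \<in> carrier KM"
    by (simp_all add: carrier_times_idem carrier_idem_bimodule)
  let ?r = "a \<otimes>\<^bsub>KM\<^esub> eb"
  have r: "?r \<in> carrier KG"
    by (rule idem_bimodule_mult_idem[OF a])
  have "pure_tensor KG Ue eKM v a \<bullet>\<^bsub>?T\<^esub> eb = pure_tensor KG Ue eKM v (lact eKM ?r eb)"
    using r by (simp add: pure_ract[OF v a idem_alg] idem_bimodule_simps idem_mult_local_alg)
  also have "\<dots> = pure_tensor KG Ue eKM (v \<bullet>\<^bsub>U\<^esub> a \<bullet>\<^bsub>U\<^esub> eb) eb"
    using pure_balanced[OF v r idem_in_bimodule] U.ract_mult[OF v' a' idem_alg]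
    by (simp add: times_idem_simps)
  finally show "pure_tensor KG Ue eKM v a \<bullet>\<^bsub>?T\<^esub> eb =
      pure_tensor KG Ue eKM (Ind_natural U (pure_tensor KG Ue eKM v a) \<bullet>\<^bsub>U\<^esub> eb) eb"
    by (simp add: natural_pure[OF v a])
qed

lemma kernel_natural_ract_idem:
  assumes x: "x \<in> carrier (tensor KG Ue eKM)" "Ind_natural U x = \<zero>\<^bsub>U\<^esub>"
  shows "x \<bullet>\<^bsub>tensor KG Ue eKM\<^esub> eb = \<zero>\<^bsub>tensor KG Ue eKM\<^esub>"
  using additive_hom_zero[OF U.V.abelian_group_axioms U.V.abelian_group_axioms U.ract_hom[OF idem_alg]]
    additive_hom_zero[OF abelian_group_times_idem abelian_group_tensor pure_left_hom[OF idem_in_bimodule]]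
  by (simp add: Ind_ract_idem[OF x(1)] x(2) times_idem_simps)

text \<open>
  The tensors \<open>v \<otimes> e\<close> generate the induced module, as \<open>v \<otimes> a = (v \<otimes> e)a\<close> for \<open>a \<in> eKS\<close>.
\<close>

lemma submodule_tensor_eq:
  assumes L: "submodule_of KM L (tensor KG Ue eKM)"
    and pure: "\<And>v. v \<in> carrier Ue \<Longrightarrow> pure_tensor KG Ue eKM v eb \<in> L"
  shows "L = carrier (tensor KG Ue eKM)"
proof (rule tensor_generated_by_pure)
  show "additive_subgroup L (tensor KG Ue eKM)"
    using L by (simp add: submodule_of_def)
  fix v a assume v: "v \<in> carrier Ue" and a: "a \<in> carrier eKM"
  then have "pure_tensor KG Ue eKM v eb \<bullet>\<^bsub>tensor KG Ue eKM\<^esub> a \<in> L"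
    using L pure by (simp add: submodule_of_def carrier_idem_bimodule)
  moreover have "pure_tensor KG Ue eKM v eb \<bullet>\<^bsub>tensor KG Ue eKM\<^esub> a = pure_tensor KG Ue eKM v a"
    using a pure_ract[OF v idem_in_bimodule, of a]
    by (simp add: carrier_idem_bimodule idem_bimodule_simps)
  ultimately show "pure_tensor KG Ue eKM v a \<in> L" by simp
qed

text \<open>
  A maximal submodule \<open>L\<close> missing an element of the kernel \<open>Q\<close> satisfies \<open>L + Q = P\<close>. Writing
  \<open>v \<otimes> e = l + k\<close> accordingly and multiplying by \<open>e\<close> removes \<open>k\<close>, so \<open>v \<otimes> e = le \<in> L\<close>
  and \<open>L\<close> is everything.
\<close>

lemma kernel_natural_rad:
  "a_kernel (tensor KG Ue eKM) U (Ind_natural U) \<subseteq> rmodule_rad KM (tensor KG Ue eKM)"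
proof
  let ?T = "tensor KG Ue eKM" and ?\<phi> = "Ind_natural U"
  interpret T: right_module KM ?T by (rule right_module_tensor)
  interpret \<phi>: group_hom "add_monoid ?T" "add_monoid U" ?\<phi>
    by (rule additive_hom_group_hom[OF abelian_group_tensor U.V.abelian_group_axioms natural_hom])
  fix x assume x: "x \<in> a_kernel ?T U ?\<phi>"
  let ?K = "a_kernel ?T U ?\<phi>"
  have K: "y \<in> ?K \<longleftrightarrow> y \<in> carrier ?T \<and> ?\<phi> y = \<zero>\<^bsub>U\<^esub>" for y
    by (simp add: a_kernel_def')
  have K_sub: "additive_subgroup ?K ?T"
    by (intro additive_subgroup.intro) (simp add: a_kernel_def \<phi>.subgroup_kernel)
  have K_ract: "y \<bullet>\<^bsub>?T\<^esub> r \<in> ?K" if "y \<in> ?K" "r \<in> carrier KM" for y r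
    using that additive_hom_zero[OF U.V.abelian_group_axioms U.V.abelian_group_axioms U.ract_hom[of r]]
    by (simp add: K natural_ract T.ract_closed)
  have "x \<in> L" if L: "maximal_submodule_of KM L ?T" for L
  proof (rule ccontr)
    assume "x \<notin> L"
    from L have sub: "additive_subgroup L ?T"
      and L_ract: "\<And>y r. y \<in> L \<Longrightarrow> r \<in> carrier KM \<Longrightarrow> y \<bullet>\<^bsub>?T\<^esub> r \<in> L"
      by (auto simp: maximal_submodule_of_def submodule_of_def)
    interpret L: additive_subgroup L ?T by (rule sub)
    interpret K: additive_subgroup ?K ?T by (rule K_sub)
    define J where "J = L <+>\<^bsub>?T\<^esub> ?K"
    have J: "y \<in> J \<longleftrightarrow> (\<exists>l\<in>L. \<exists>k\<in>?K. y = l \<oplus>\<^bsub>?T\<^esub> k)" for y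
      by (auto simp: J_def set_add_def set_mult_def)
    have "additive_subgroup J ?T"
      unfolding J_def by (rule T.V.add_additive_subgroups[OF sub K_sub])
    moreover have "y \<bullet>\<^bsub>?T\<^esub> r \<in> J" if "y \<in> J" "r \<in> carrier KM" for y r
    proof -
      from that(1) obtain l k where lk: "l \<in> L" "k \<in> ?K" "y = l \<oplus>\<^bsub>?T\<^esub> k"
        unfolding J by blast
      then have "y \<bullet>\<^bsub>?T\<^esub> r = l \<bullet>\<^bsub>?T\<^esub> r \<oplus>\<^bsub>?T\<^esub> k \<bullet>\<^bsub>?T\<^esub> r"
        using that(2) L.a_subset K.a_subset
        by (simp only: T.ract_add subsetD[OF L.a_subset] subsetD[OF K.a_subset])
      then show ?thesis
        unfolding J using lk L_ract K_ract that(2) by blast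
    qed
    ultimately have "submodule_of KM J ?T"
      by (simp add: submodule_of_def)
    moreover have "L \<subseteq> J"
    proof
      fix l assume "l \<in> L"
      then show "l \<in> J"
        unfolding J using K.zero_closed L.a_subset
        by (intro bexI[of _ l] bexI[of _ "\<zero>\<^bsub>?T\<^esub>"]) auto
    qed
    moreover have "x \<in> J"
      unfolding J using x L.zero_closed K.a_subset
      by (intro bexI[of _ x] bexI[of _ "\<zero>\<^bsub>?T\<^esub>"]) auto
    ultimately have "J = carrier ?T"
      using L \<open>x \<notin> L\<close> unfolding maximal_submodule_of_def by blast
    have "pure_tensor KG Ue eKM v eb \<in> L" if v: "v \<in> carrier Ue" for v
    proof -
      have "pure_tensor KG Ue eKM v eb \<in> J"
        using pure_closed[OF v idem_in_bimodule] \<open>J = carrier ?T\<close> by simp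
      then obtain l k where lk: "l \<in> L" "k \<in> ?K" "pure_tensor KG Ue eKM v eb = l \<oplus>\<^bsub>?T\<^esub> k"
        unfolding J by blast
      have "pure_tensor KG Ue eKM v eb = pure_tensor KG Ue eKM v eb \<bullet>\<^bsub>?T\<^esub> eb"
        using pure_ract[OF v idem_in_bimodule idem_alg] by (simp add: idem_bimodule_simps idem_idem)
      also have "\<dots> = l \<bullet>\<^bsub>?T\<^esub> eb \<oplus>\<^bsub>?T\<^esub> k \<bullet>\<^bsub>?T\<^esub> eb"
        using lk(1,2)
        by (simp only: lk(3) T.ract_add subsetD[OF L.a_subset] subsetD[OF K.a_subset] idem_alg)
      also have "\<dots> = l \<bullet>\<^bsub>?T\<^esub> eb"
        using lk(1,2) L_ract[OF _ idem_alg, of l] L.a_subset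
        by (auto simp: K kernel_natural_ract_idem)
      finally show ?thesis
        using L_ract[OF lk(1) idem_alg] by simp
    qed
    then have "L = carrier ?T"
      using L by (intro submodule_tensor_eq) (simp_all add: maximal_submodule_of_def)
    then show False
      using L by (simp add: maximal_submodule_of_def)
  qed
  then show "x \<in> rmodule_rad KM ?T"
    using x by (simp add: rmodule_rad_def K)
qed

end

end

section \<open>Projectivity from a dual basis\<close>

definition regular_rmodule :: "'r ring \<Rightarrow> ('r, 'r) rmodule"
  where "regular_rmodule R = \<lparr>carrier = carrier R, monoid.mult = undefined, one = undefined,
    ring.zero = \<zero>\<^bsub>R\<^esub>, ring.add = ring.add R, ract = monoid.mult R\<rparr>"

lemma regular_rmodule_simps:
  "carrier (regular_rmodule R) = carrier R"
  "x \<oplus>\<^bsub>regular_rmodule R\<^esub> y = x \<oplus>\<^bsub>R\<^esub> y"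
  "\<zero>\<^bsub>regular_rmodule R\<^esub> = \<zero>\<^bsub>R\<^esub>"
  "x \<bullet>\<^bsub>regular_rmodule R\<^esub> y = x \<otimes>\<^bsub>R\<^esub> y"
  by (simp_all add: regular_rmodule_def)

lemma right_module_regular:
  assumes "ring R"
  shows "right_module R (regular_rmodule R)"
proof -
  interpret R: ring R by fact
  show ?thesis
  proof (intro right_module.intro right_module_axioms.intro assms)
    show "abelian_group (regular_rmodule R)"
      by (rule abelian_groupI)
        (auto simp: regular_rmodule_simps R.a_ac intro: R.l_neg exI bexI[of _ "\<ominus>\<^bsub>R\<^esub> _"])
  qed (auto simp: regular_rmodule_simps R.l_distr R.r_distr R.m_assoc)
qed

text \<open>
  If \<open>t\<^sub>i\<close> lifts \<open>f(x\<^sub>i)\<close> along \<open>g\<close>, then \<open>p \<mapsto> \<Sum>\<^sub>i t\<^sub>i C\<^sub>i(p)\<close> lifts \<open>f\<close>. Equivalently, the dual basis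
  exhibits \<open>P\<close> as a direct summand of a free module of finite rank.
\<close>

lemma projective_rmodule_dual_basis:
  fixes R :: "'r ring" and P :: "('r, 'm) rmodule"
  assumes P: "right_module R P" and fin: "finite I"
    and x: "\<And>i. i \<in> I \<Longrightarrow> x i \<in> carrier P"
    and C: "\<And>i. i \<in> I \<Longrightarrow> C i \<in> rmodule_hom R P (regular_rmodule R)"
    and dual: "\<And>p. p \<in> carrier P \<Longrightarrow> p = (\<Oplus>\<^bsub>P\<^esub>i\<in>I. x i \<bullet>\<^bsub>P\<^esub> C i p)"
  shows "projective_rmodule TYPE('b) TYPE('c) R P"
  unfolding projective_rmodule_def
proof (intro conjI allI impI P)
  fix A :: "('r, 'b) rmodule" and B :: "('r, 'c) rmodule" and g f
  assume "right_module R A \<and> right_module R B \<and> g \<in> rmodule_epi R A B \<and> f \<in> rmodule_hom R P B"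
  then have A: "right_module R A" and B: "right_module R B"
    and g: "g \<in> rmodule_hom R A B" "g ` carrier A = carrier B" and f: "f \<in> rmodule_hom R P B"
    by (auto simp: rmodule_epi_def)
  interpret P: right_module R P by (rule P)
  interpret A: right_module R A by (rule A)
  interpret B: right_module R B by (rule B)
  have g_hom: "g \<in> hom (add_monoid A) (add_monoid B)" and f_hom: "f \<in> hom (add_monoid P) (add_monoid B)"
    and g_ract: "\<And>a r. a \<in> carrier A \<Longrightarrow> r \<in> carrier R \<Longrightarrow> g (a \<bullet>\<^bsub>A\<^esub> r) = g a \<bullet>\<^bsub>B\<^esub> r"
    and f_ract: "\<And>p r. p \<in> carrier P \<Longrightarrow> r \<in> carrier R \<Longrightarrow> f (p \<bullet>\<^bsub>P\<^esub> r) = f p \<bullet>\<^bsub>B\<^esub> r"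
    using g f by (auto simp: rmodule_hom_def)
  have C_closed: "\<And>i p. i \<in> I \<Longrightarrow> p \<in> carrier P \<Longrightarrow> C i p \<in> carrier R"
    and C_add: "\<And>i p q. i \<in> I \<Longrightarrow> p \<in> carrier P \<Longrightarrow> q \<in> carrier P \<Longrightarrow>
      C i (p \<oplus>\<^bsub>P\<^esub> q) = C i p \<oplus>\<^bsub>R\<^esub> C i q"
    and C_ract: "\<And>i p r. i \<in> I \<Longrightarrow> p \<in> carrier P \<Longrightarrow> r \<in> carrier R \<Longrightarrow>
      C i (p \<bullet>\<^bsub>P\<^esub> r) = C i p \<otimes>\<^bsub>R\<^esub> r"
    using C by (auto simp: rmodule_hom_def hom_def regular_rmodule_simps Pi_iff)
  have "\<exists>a\<in>carrier A. g a = f (x i)" if "i \<in> I" for i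
    using additive_hom_closed[OF f_hom x[OF that]] g(2) by (metis imageE)
  then obtain t where t: "\<And>i. i \<in> I \<Longrightarrow> t i \<in> carrier A" "\<And>i. i \<in> I \<Longrightarrow> g (t i) = f (x i)"
    by metis
  define h where "h p = (\<Oplus>\<^bsub>A\<^esub>i\<in>I. t i \<bullet>\<^bsub>A\<^esub> C i p)" for p
  have term_closed: "(\<lambda>i. t i \<bullet>\<^bsub>A\<^esub> C i p) \<in> I \<rightarrow> carrier A" if "p \<in> carrier P" for p
    using that t C_closed by (auto intro!: A.ract_closed)
  have "h (p \<oplus>\<^bsub>P\<^esub> q) = h p \<oplus>\<^bsub>A\<^esub> h q" if pq: "p \<in> carrier P" "q \<in> carrier P" for p q
  proof -
    have "h (p \<oplus>\<^bsub>P\<^esub> q) = (\<Oplus>\<^bsub>A\<^esub>i\<in>I. t i \<bullet>\<^bsub>A\<^esub> C i p \<oplus>\<^bsub>A\<^esub> t i \<bullet>\<^bsub>A\<^esub> C i q)"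
      unfolding h_def using pq t C_closed
      by (intro A.V.finsum_cong') (auto simp: C_add A.add_ract intro!: A.ract_closed)
    also have "\<dots> = h p \<oplus>\<^bsub>A\<^esub> h q"
      unfolding h_def using pq by (intro A.V.finsum_addf term_closed)
    finally show ?thesis .
  qed
  moreover have "h (p \<bullet>\<^bsub>P\<^esub> r) = h p \<bullet>\<^bsub>A\<^esub> r" if pr: "p \<in> carrier P" "r \<in> carrier R" for p r
  proof -
    have "h (p \<bullet>\<^bsub>P\<^esub> r) = (\<Oplus>\<^bsub>A\<^esub>i\<in>I. t i \<bullet>\<^bsub>A\<^esub> C i p \<bullet>\<^bsub>A\<^esub> r)"
      unfolding h_def using pr t C_closed
      by (intro A.V.finsum_cong') (auto simp: C_ract A.ract_mult intro!: A.ract_closed)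
    also have "\<dots> = h p \<bullet>\<^bsub>A\<^esub> r"
      unfolding h_def using pr
      by (intro additive_hom_finsum[symmetric] A.V.abelian_group_axioms A.ract_hom term_closed fin)
    finally show ?thesis .
  qed
  moreover have "h p \<in> carrier A" if "p \<in> carrier P" for p
    unfolding h_def using that by (intro A.V.finsum_closed term_closed)
  ultimately have "h \<in> rmodule_hom R P A"
    by (auto simp: rmodule_hom_def hom_def)
  moreover have "g (h p) = f p" if p: "p \<in> carrier P" for p
  proof -
    have "g (h p) = (\<Oplus>\<^bsub>B\<^esub>i\<in>I. g (t i \<bullet>\<^bsub>A\<^esub> C i p))"
      unfolding h_def
      by (intro additive_hom_finsum A.V.abelian_group_axioms B.V.abelian_group_axioms g_hom fin
          term_closed p)
    also have "\<dots> = (\<Oplus>\<^bsub>B\<^esub>i\<in>I. f (x i \<bullet>\<^bsub>P\<^esub> C i p))"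
      using p t x C_closed additive_hom_closed[OF f_hom]
      by (intro B.V.finsum_cong') (auto simp: g_ract f_ract intro!: B.ract_closed)
    also have "\<dots> = f (\<Oplus>\<^bsub>P\<^esub>i\<in>I. x i \<bullet>\<^bsub>P\<^esub> C i p)"
      using p x C_closed
      by (intro additive_hom_finsum[symmetric] P.V.abelian_group_axioms B.V.abelian_group_axioms
          f_hom fin) (auto intro!: P.ract_closed)
    also have "\<dots> = f p"
      using dual[OF p] by simp
    finally show ?thesis .
  qed
  ultimately show "\<exists>h\<in>rmodule_hom R P A. \<forall>p\<in>carrier P. g (h p) = f p"
    by blast
qed

context local_module
begin

text \<open>
  Induction carries a dual basis \<open>x\<^sub>i, c\<^sub>i\<close> of \<open>Ue\<close> over \<open>KG\<^sub>e\<close> to the dual basis \<open>x\<^sub>i \<otimes> e\<close>,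
  \<open>v \<otimes> a \<mapsto> c\<^sub>i(v)a\<close> of the induced module: the reconstruction identity on a pure tensor is
  \<open>\<Sum>\<^sub>i (x\<^sub>i \<otimes> e)c\<^sub>i(v)a = \<Sum>\<^sub>i x\<^sub>i c\<^sub>i(v) \<otimes> a = v \<otimes> a\<close>.
\<close>

lemma projective_Ind_dual_basis:
  assumes fin: "finite I"
    and x: "\<And>i. i \<in> I \<Longrightarrow> x i \<in> carrier Ue"
    and c: "\<And>i. i \<in> I \<Longrightarrow> c i \<in> rmodule_hom KG Ue (regular_rmodule KG)"
    and dual: "\<And>v. v \<in> carrier Ue \<Longrightarrow> v = (\<Oplus>\<^bsub>Ue\<^esub>i\<in>I. x i \<bullet>\<^bsub>U\<^esub> c i v)"
  shows "projective_rmodule TYPE('b) TYPE('c) KM (tensor KG Ue eKM)"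
proof -
  let ?T = "tensor KG Ue eKM" and ?R = "regular_rmodule KM"
  interpret T: right_module KM ?T by (rule right_module_tensor)
  interpret R: right_module KM ?R by (rule right_module_regular[OF ring_alg])
  have c_closed: "c i v \<in> carrier KG" if "i \<in> I" "v \<in> carrier Ue" for i v
    using c[OF that(1)] that(2) by (auto simp: rmodule_hom_def hom_def regular_rmodule_simps)
  have c_add: "c i (v \<oplus>\<^bsub>U\<^esub> w) = c i v \<oplus>\<^bsub>KM\<^esub> c i w"
    if "i \<in> I" "v \<in> carrier Ue" "w \<in> carrier Ue" for i v w
    using c[OF that(1)] that(2,3)
    by (auto simp: rmodule_hom_def hom_def regular_rmodule_simps times_idem_simps add_monoid_algebra)
  have c_ract: "c i (v \<bullet>\<^bsub>U\<^esub> r) = c i v \<otimes>\<^bsub>KM\<^esub> r"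
    if "i \<in> I" "v \<in> carrier Ue" "r \<in> carrier KG" for i v r
    using c[OF that(1)] that(2,3) c_closed[OF that(1,2)]
    by (auto simp: rmodule_hom_def regular_rmodule_simps times_idem_simps local_alg_mult)
  define b where "b i v a = c i v \<otimes>\<^bsub>KM\<^esub> a" for i v a
  have b: "balanced ?R (b i)" if i: "i \<in> I" for i
    unfolding balanced_def b_def
  proof (intro conjI ballI)
    show "(\<otimes>\<^bsub>KM\<^esub>) (c i v) \<in> hom (add_monoid eKM) (add_monoid ?R)" if "v \<in> carrier Ue" for v
      using that i by (auto simp: hom_def carrier_idem_bimodule regular_rmodule_simps
          idem_bimodule_simps c_closed local_alg_mem U.R.r_distr)
    show "(\<lambda>v. c i v \<otimes>\<^bsub>KM\<^esub> a) \<in> hom (add_monoid Ue) (add_monoid ?R)" if "a \<in> carrier eKM" for a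
      using that i by (auto simp: hom_def carrier_idem_bimodule regular_rmodule_simps
          times_idem_simps c_closed local_alg_mem U.R.l_distr c_add)
    show "c i (v \<bullet>\<^bsub>Ue\<^esub> r) \<otimes>\<^bsub>KM\<^esub> a = c i v \<otimes>\<^bsub>KM\<^esub> lact eKM r a"
      if "v \<in> carrier Ue" "r \<in> carrier KG" "a \<in> carrier eKM" for v r a
      using that i by (simp add: carrier_idem_bimodule times_idem_simps idem_bimodule_simps
          c_closed local_alg_mem c_ract U.R.m_assoc)
  qed
  define C where "C i = tensor_lift ?R (b i)" for i
  have C: "C i \<in> rmodule_hom KM ?T ?R" if i: "i \<in> I" for i
    unfolding C_def using i
    by (intro tensor_lift_rmodule_hom R.right_module_axioms b)
      (simp_all add: b_def idem_bimodule_simps regular_rmodule_simps carrier_idem_bimodule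
        c_closed local_alg_mem U.R.m_assoc)
  have C_pure: "C i (pure_tensor KG Ue eKM v a) = c i v \<otimes>\<^bsub>KM\<^esub> a"
    if "i \<in> I" "v \<in> carrier Ue" "a \<in> carrier eKM" for i v a
    unfolding C_def using tensor_lift_pure[OF R.V.abelian_group_axioms b] that by (simp add: b_def)
  show ?thesis
  proof (rule projective_rmodule_dual_basis[OF T.right_module_axioms fin _ C])
    show px: "pure_tensor KG Ue eKM (x i) eb \<in> carrier ?T" if "i \<in> I" for i
      using that by (intro pure_closed x idem_in_bimodule)
    show "p = (\<Oplus>\<^bsub>?T\<^esub>i\<in>I. pure_tensor KG Ue eKM (x i) eb \<bullet>\<^bsub>?T\<^esub> C i p)" if p: "p \<in> carrier ?T" for p
    proof (rule tensor_hom_eqI[OF abelian_group_tensor _ _ _ p])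
      show "(\<lambda>p. p) \<in> hom (add_monoid ?T) (add_monoid ?T)"
        by (auto simp: hom_def)
      show "(\<lambda>p. \<Oplus>\<^bsub>?T\<^esub>i\<in>I. pure_tensor KG Ue eKM (x i) eb \<bullet>\<^bsub>?T\<^esub> C i p)
          \<in> hom (add_monoid ?T) (add_monoid ?T)"
      proof (rule finsum_hom[OF abelian_group_tensor abelian_group_tensor])
        fix i assume i: "i \<in> I"
        have "C i \<in> hom (add_monoid ?T) (add_monoid KM)"
          using C[OF i] by (auto simp: rmodule_hom_def hom_def regular_rmodule_simps)
        from hom_compose[OF this T.ract_hom_right[OF px[OF i]]]
        show "(\<lambda>p. pure_tensor KG Ue eKM (x i) eb \<bullet>\<^bsub>?T\<^esub> C i p) \<in> hom (add_monoid ?T) (add_monoid ?T)"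
          by (simp add: comp_def)
      qed
      fix v a assume v: "v \<in> carrier Ue" and a: "a \<in> carrier eKM"
      have summand: "pure_tensor KG Ue eKM (x i) eb \<bullet>\<^bsub>?T\<^esub> C i (pure_tensor KG Ue eKM v a) =
          pure_tensor KG Ue eKM (x i \<bullet>\<^bsub>U\<^esub> c i v) a" if i: "i \<in> I" for i
      proof -
        have a': "a \<in> carrier KM" "eb \<otimes>\<^bsub>KM\<^esub> a = a" and r: "c i v \<in> carrier KM"
          using a c_closed[OF i v] by (simp_all add: carrier_idem_bimodule local_alg_mem)
        have "pure_tensor KG Ue eKM (x i) eb \<bullet>\<^bsub>?T\<^esub> C i (pure_tensor KG Ue eKM v a) =
            pure_tensor KG Ue eKM (x i) (eb \<otimes>\<^bsub>KM\<^esub> (c i v \<otimes>\<^bsub>KM\<^esub> a))"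
          using pure_ract[OF x[OF i] idem_in_bimodule, of "c i v \<otimes>\<^bsub>KM\<^esub> a"] a' r
          by (simp add: C_pure[OF i v a] idem_bimodule_simps)
        also have "eb \<otimes>\<^bsub>KM\<^esub> (c i v \<otimes>\<^bsub>KM\<^esub> a) = lact eKM (c i v) a"
          using a' r c_closed[OF i v]
          by (simp add: idem_bimodule_simps idem_alg idem_mult_local_alg flip: U.R.m_assoc)
        also have "pure_tensor KG Ue eKM (x i) \<dots> = pure_tensor KG Ue eKM (x i \<bullet>\<^bsub>U\<^esub> c i v) a"
          using pure_balanced[OF x[OF i] c_closed[OF i v] a] by (simp add: times_idem_simps)
        finally show ?thesis .
      qed
      have cl: "x i \<bullet>\<^bsub>U\<^esub> c i v \<in> carrier Ue" if "i \<in> I" for i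
        using V.ract_closed[OF x[OF that] c_closed[OF that v]] by (simp add: times_idem_simps)
      have "(\<Oplus>\<^bsub>?T\<^esub>i\<in>I. pure_tensor KG Ue eKM (x i) eb \<bullet>\<^bsub>?T\<^esub> C i (pure_tensor KG Ue eKM v a)) =
          (\<Oplus>\<^bsub>?T\<^esub>i\<in>I. pure_tensor KG Ue eKM (x i \<bullet>\<^bsub>U\<^esub> c i v) a)"
        by (rule T.V.finsum_cong') (auto simp: summand intro!: pure_closed cl a)
      also have "\<dots> = pure_tensor KG Ue eKM (\<Oplus>\<^bsub>Ue\<^esub>i\<in>I. x i \<bullet>\<^bsub>U\<^esub> c i v) a"
        by (rule additive_hom_finsum[symmetric, OF abelian_group_times_idem abelian_group_tensor
              pure_left_hom[OF a] fin]) (simp add: cl)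
      also have "\<dots> = pure_tensor KG Ue eKM v a"
        using dual[OF v] by simp
      finally show "pure_tensor KG Ue eKM v a =
          (\<Oplus>\<^bsub>?T\<^esub>i\<in>I. pure_tensor KG Ue eKM (x i) eb \<bullet>\<^bsub>?T\<^esub> C i (pure_tensor KG Ue eKM v a))"
        by simp
    qed
  qed
qed

end

section \<open>Transformation modules\<close>

locale finite_transf_monoid =
  fixes M :: "('a::finite \<Rightarrow> 'a) set"
  assumes submonoid: "submonoid M full_transf"
begin

lemma id_in: "id \<in> M" and comp_in: "m \<in> M \<Longrightarrow> n \<in> M \<Longrightarrow> n \<circ> m \<in> M"
  using submonoid.one_closed[OF submonoid] submonoid.m_closed[OF submonoid, of m n]
  by (simp_all add: full_transf_def)

lemma transf_monoid_simps:
  "carrier (transf_monoid M) = M" "m \<otimes>\<^bsub>transf_monoid M\<^esub> n = n \<circ> m" "\<one>\<^bsub>transf_monoid M\<^esub> = id"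
  by (simp_all add: transf_monoid_def full_transf_def)

lemma finite_monoid_transf: "finite_monoid (transf_monoid M)"
  by (intro finite_monoid.intro finite_monoid_axioms.intro monoidI)
    (auto simp: transf_monoid_simps id_in comp_in comp_assoc)

lemma transf_module_simps:
  fixes v w :: "'a \<Rightarrow> 'k::field"
  shows "carrier (transf_module M) = (UNIV :: ('a \<Rightarrow> 'k) set)"
    "v \<oplus>\<^bsub>transf_module M\<^esub> w = (\<lambda>\<beta>. v \<beta> + w \<beta>)"
    "\<zero>\<^bsub>transf_module M\<^esub> = (\<lambda>_. 0 :: 'k)"
    "v \<bullet>\<^bsub>transf_module M\<^esub> f = (\<lambda>\<beta>. \<Sum>\<alpha>\<in>UNIV. \<Sum>m\<in>M. if m \<alpha> = \<beta> then v \<alpha> * f m else 0)"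
  by (simp_all add: transf_module_def)

text \<open>
  As for the monoid algebra, pairing with a test function reduces the module law
  \<open>v(rs) = (vr)s\<close> to the action of maps on points.
\<close>

lemma sum_ract_transf:
  fixes v F :: "'a \<Rightarrow> 'k::field"
  shows "(\<Sum>\<beta>\<in>UNIV. (v \<bullet>\<^bsub>transf_module M\<^esub> f) \<beta> * F \<beta>) = (\<Sum>\<alpha>\<in>UNIV. \<Sum>m\<in>M. v \<alpha> * f m * F (m \<alpha>))"
proof -
  have "(\<Sum>\<beta>\<in>UNIV. (v \<bullet>\<^bsub>transf_module M\<^esub> f) \<beta> * F \<beta>) =
      (\<Sum>\<beta>\<in>UNIV. \<Sum>\<alpha>\<in>UNIV. \<Sum>m\<in>M. (if m \<alpha> = \<beta> then v \<alpha> * f m else 0) * F \<beta>)"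
    by (simp add: transf_module_simps sum_distrib_right)
  also have "\<dots> = (\<Sum>\<alpha>\<in>UNIV. \<Sum>\<beta>\<in>UNIV. \<Sum>m\<in>M. (if m \<alpha> = \<beta> then v \<alpha> * f m else 0) * F \<beta>)"
    by (rule sum.swap)
  also have "\<dots> = (\<Sum>\<alpha>\<in>UNIV. \<Sum>m\<in>M. \<Sum>\<beta>\<in>UNIV. (if m \<alpha> = \<beta> then v \<alpha> * f m else 0) * F \<beta>)"
    by (intro sum.cong refl sum.swap)
  also have "\<dots> = (\<Sum>\<alpha>\<in>UNIV. \<Sum>m\<in>M. v \<alpha> * f m * F (m \<alpha>))"
    by (intro sum.cong refl sum_delta_mult) auto
  finally show ?thesis .
qed

lemma ract_transf_basis:
  fixes v :: "'a \<Rightarrow> 'k::field"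
  assumes "m \<in> M"
  shows "(v \<bullet>\<^bsub>transf_module M\<^esub> basis_elt m) \<beta> = (\<Sum>\<alpha>\<in>UNIV. if m \<alpha> = \<beta> then v \<alpha> else 0)"
  unfolding transf_module_simps
proof (rule sum.cong[OF refl])
  fix \<alpha>
  have "(\<Sum>n\<in>M. if n \<alpha> = \<beta> then v \<alpha> * basis_elt m n else 0) =
      (\<Sum>n\<in>M. if n = m then (if m \<alpha> = \<beta> then v \<alpha> else 0) else 0)"
    by (rule sum.cong) (auto simp: basis_elt_def)
  then show "(\<Sum>n\<in>M. if n \<alpha> = \<beta> then v \<alpha> * basis_elt m n else 0) = (if m \<alpha> = \<beta> then v \<alpha> else 0)"
    using assms by simp
qed

lemma right_module_transf:
  "right_module (monoid_algebra (transf_monoid M))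
    (transf_module M :: (('a \<Rightarrow> 'a) \<Rightarrow> 'k::field, 'a \<Rightarrow> 'k) rmodule)"
proof -
  interpret finite_monoid "transf_monoid M" by (rule finite_monoid_transf)
  let ?V = "transf_module M :: (('a \<Rightarrow> 'a) \<Rightarrow> 'k, 'a \<Rightarrow> 'k) rmodule"
  show ?thesis
  proof (intro right_module.intro right_module_axioms.intro ring_alg)
    show "abelian_group ?V"
    proof (rule abelian_groupI)
      fix v :: "'a \<Rightarrow> 'k"
      show "\<exists>w\<in>carrier ?V. w \<oplus>\<^bsub>?V\<^esub> v = \<zero>\<^bsub>?V\<^esub>"
        by (rule bexI[of _ "\<lambda>\<beta>. - v \<beta>"]) (auto simp: transf_module_simps)
    qed (auto simp: transf_module_simps algebra_simps)
    fix v w :: "'a \<Rightarrow> 'k" and r s :: "('a \<Rightarrow> 'a) \<Rightarrow> 'k"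
    show "v \<bullet>\<^bsub>?V\<^esub> r \<in> carrier ?V"
      by (simp add: transf_module_simps)
    show "(v \<oplus>\<^bsub>?V\<^esub> w) \<bullet>\<^bsub>?V\<^esub> r = v \<bullet>\<^bsub>?V\<^esub> r \<oplus>\<^bsub>?V\<^esub> w \<bullet>\<^bsub>?V\<^esub> r"
      by (rule ext, unfold transf_module_simps sum.distrib[symmetric], intro sum.cong refl)
        (simp add: distrib_right)
    show "v \<bullet>\<^bsub>?V\<^esub> (r \<oplus>\<^bsub>alg\<^esub> s) = v \<bullet>\<^bsub>?V\<^esub> r \<oplus>\<^bsub>?V\<^esub> v \<bullet>\<^bsub>?V\<^esub> s"
      unfolding add_monoid_algebra
      by (rule ext, unfold transf_module_simps sum.distrib[symmetric], intro sum.cong refl)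
        (simp add: distrib_left)
    show "v \<bullet>\<^bsub>?V\<^esub> (r \<otimes>\<^bsub>alg\<^esub> s) = v \<bullet>\<^bsub>?V\<^esub> r \<bullet>\<^bsub>?V\<^esub> s"
    proof
      fix \<gamma> :: 'a
      let ?d = "\<lambda>\<beta>. if \<beta> = \<gamma> then 1 else 0 :: 'k"
      have "(v \<bullet>\<^bsub>?V\<^esub> (r \<otimes>\<^bsub>alg\<^esub> s)) \<gamma> =
          (\<Sum>\<alpha>\<in>UNIV. v \<alpha> * (\<Sum>p\<in>M. (r \<otimes>\<^bsub>alg\<^esub> s) p * ?d (p \<alpha>)))"
        by (subst transf_module_simps) (auto simp: sum_distrib_left intro!: sum.cong)
      also have "\<dots> = (\<Sum>\<alpha>\<in>UNIV. v \<alpha> * (\<Sum>m\<in>M. \<Sum>n\<in>M. r m * s n * ?d (n (m \<alpha>))))"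
        using sum_mult_alg[of r s, unfolded transf_monoid_simps] by simp
      also have "\<dots> = (\<Sum>\<alpha>\<in>UNIV. \<Sum>m\<in>M. v \<alpha> * r m * (\<Sum>n\<in>M. s n * ?d (n (m \<alpha>))))"
        by (auto simp: sum_distrib_left mult.assoc intro!: sum.cong)
      also have "\<dots> = (\<Sum>\<beta>\<in>UNIV. (v \<bullet>\<^bsub>?V\<^esub> r) \<beta> * (\<Sum>n\<in>M. s n * ?d (n \<beta>)))"
        by (rule sum_ract_transf[symmetric])
      also have "\<dots> = (v \<bullet>\<^bsub>?V\<^esub> r \<bullet>\<^bsub>?V\<^esub> s) \<gamma>"
        by (subst (2) transf_module_simps) (auto simp: sum_distrib_left intro!: sum.cong)
      finally show "(v \<bullet>\<^bsub>?V\<^esub> (r \<otimes>\<^bsub>alg\<^esub> s)) \<gamma> = (v \<bullet>\<^bsub>?V\<^esub> r \<bullet>\<^bsub>?V\<^esub> s) \<gamma>" .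
    qed
    show "v \<bullet>\<^bsub>?V\<^esub> \<one>\<^bsub>alg\<^esub> = v"
      by (rule ext) (simp add: one_monoid_algebra transf_monoid_simps ract_transf_basis id_in)
  qed
qed

end

lemma finsum_pointwise:
  fixes V :: "('a \<Rightarrow> 'k::comm_monoid_add, 'x) ring_scheme"
  assumes V: "abelian_group V"
    and add: "\<And>v w. v \<oplus>\<^bsub>V\<^esub> w = (\<lambda>\<beta>. v \<beta> + w \<beta>)" and zero: "\<zero>\<^bsub>V\<^esub> = (\<lambda>_. 0)"
    and "finite I" "f \<in> I \<rightarrow> carrier V"
  shows "(\<Oplus>\<^bsub>V\<^esub>i\<in>I. f i) = (\<lambda>\<beta>. \<Sum>i\<in>I. f i \<beta>)"
  using assms(4,5)
proof (induction I rule: finite_induct)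
  case empty
  interpret V: abelian_group V by (rule V)
  show ?case by (simp add: zero)
next
  case (insert i I)
  interpret V: abelian_group V by (rule V)
  from insert show ?case
    by (auto simp: Pi_iff add)
qed

locale transf_idempotent = finite_transf_monoid M for M :: "('a::finite \<Rightarrow> 'a) set" +
  fixes e
  assumes e_minimal: "e \<in> idempotents (transf_monoid M) (minimal_ideal (transf_monoid M))"
begin

sublocale finite_monoid_idempotent "transf_monoid M" e
proof (intro finite_monoid_idempotent.intro finite_monoid_idempotent_axioms.intro finite_monoid_transf)
  show "e \<in> carrier (transf_monoid M)"
    using e_minimal finite_monoid.ideal_minimal_ideal[OF finite_monoid_transf]
    by (auto simp: idempotents_def monoid_ideal_def)
  show "e \<otimes>\<^bsub>transf_monoid M\<^esub> e = e"
    using e_minimal by (simp add: idempotents_def)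
qed

lemma e_mem: "e \<in> M" and e_e: "e (e \<alpha>) = e \<alpha>"
  using e_closed e_idem by (simp_all add: transf_monoid_simps fun_eq_iff)

lemma sandwich_in_local_group: "m \<in> carrier (transf_monoid M) \<Longrightarrow>
    e \<otimes>\<^bsub>transf_monoid M\<^esub> m \<otimes>\<^bsub>transf_monoid M\<^esub> e \<in> carrier (local_group (transf_monoid M) e)"
  using e_minimal by (intro local_group_minimal_ideal) (auto simp: idempotents_def)

abbreviation (input) G where "G \<equiv> local_group (transf_monoid M) e"

interpretation G: group G by (rule group_local_group)

lemma finite_G: "finite (carrier G)"
  using finite_monoid_local_group by (simp add: finite_monoid_def finite_monoid_axioms_def)

lemma G_simps: "m \<otimes>\<^bsub>G\<^esub> n = n \<circ> m" "\<one>\<^bsub>G\<^esub> = e"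
  by (simp_all add: local_group_mult local_group_one transf_monoid_simps)

lemma G_mem:
  assumes "m \<in> carrier G"
  shows "m \<in> M" "m (e \<alpha>) = m \<alpha>" "e (m \<alpha>) = m \<alpha>"
  using local_group_memD[OF assms] by (auto simp: transf_monoid_simps fun_eq_iff)

text \<open>
  An element of \<open>G\<^sub>e\<close> permutes \<open>\<Omega>e\<close> and is constant on each fibre of \<open>e\<close>, so on \<open>\<Omega>\<close> its group
  inverse undoes it only up to \<open>e\<close>.
\<close>

lemma G_inv:
  assumes "m \<in> carrier G"
  shows "(inv\<^bsub>G\<^esub> m) (m \<alpha>) = e \<alpha>" "m ((inv\<^bsub>G\<^esub> m) \<alpha>) = e \<alpha>"
  using G.r_inv[OF assms] G.l_inv[OF assms] by (auto simp: G_simps fun_eq_iff)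

abbreviation (input) Omega_e where "Omega_e \<equiv> times_idem (transf_module M) e"

lemma local_module_transf:
  "local_module (transf_monoid M) e (transf_module M :: (('a \<Rightarrow> 'a) \<Rightarrow> 'k::field, 'a \<Rightarrow> 'k) rmodule)"
  by (intro local_module.intro finite_monoid_idempotent_axioms right_module_transf)

text \<open>
  The image of the idempotent \<open>e\<close> is its set of fixed points, so \<open>K\<Omega>e\<close> has the fixed points of \<open>e\<close> as a
  basis.
\<close>

lemma carrier_times_idem_transf:
  fixes v :: "'a \<Rightarrow> 'k::field"
  shows "v \<in> carrier Omega_e \<longleftrightarrow> (\<forall>\<beta>. e \<beta> \<noteq> \<beta> \<longrightarrow> v \<beta> = 0)"
proof -
  have "v \<bullet>\<^bsub>transf_module M\<^esub> basis_elt e = v \<longleftrightarrow> (\<forall>\<beta>. e \<beta> \<noteq> \<beta> \<longrightarrow> v \<beta> = 0)"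
  proof
    assume eq: "v \<bullet>\<^bsub>transf_module M\<^esub> basis_elt e = v"
    show "\<forall>\<beta>. e \<beta> \<noteq> \<beta> \<longrightarrow> v \<beta> = 0"
    proof (intro allI impI)
      fix \<beta> assume "e \<beta> \<noteq> \<beta>"
      then have "e \<alpha> \<noteq> \<beta>" for \<alpha>
        using e_e by metis
      then show "v \<beta> = 0"
        using fun_cong[OF eq, of \<beta>] by (simp add: ract_transf_basis[OF e_mem])
    qed
  next
    assume v: "\<forall>\<beta>. e \<beta> \<noteq> \<beta> \<longrightarrow> v \<beta> = 0"
    show "v \<bullet>\<^bsub>transf_module M\<^esub> basis_elt e = v"
    proof
      fix \<beta>
      have "(v \<bullet>\<^bsub>transf_module M\<^esub> basis_elt e) \<beta> = (\<Sum>\<alpha>\<in>UNIV. if \<alpha> = \<beta> then v \<alpha> else 0)"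
        unfolding ract_transf_basis[OF e_mem] using v by (intro sum.cong) auto
      then show "(v \<bullet>\<^bsub>transf_module M\<^esub> basis_elt e) \<beta> = v \<beta>" by simp
    qed
  qed
  then show ?thesis
    by (simp add: local_module.carrier_times_idem[OF local_module_transf] transf_module_simps)
qed

text \<open>
  The coordinate \<open>c\<^sub>\<beta>(v) = (1/|G|) \<Sum>\<^bsub>g\<in>G\<^esub> v(\<beta>g) g\<close>, an average over the group that depends on \<open>v\<close> only
  through the orbit of \<open>\<beta>\<close>.
\<close>

definition coord :: "'a \<Rightarrow> ('a \<Rightarrow> 'k::field) \<Rightarrow> ('a \<Rightarrow> 'a) \<Rightarrow> 'k"
  where "coord \<beta> v = (\<lambda>m. if m \<in> carrier G then v (m \<beta>) / of_nat (card (carrier G)) else 0)"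

text \<open>
  The coefficients of both sides at \<open>p \<in> G\<close> are \<open>(1/|G|) \<Sum>\<^bsub>n\<in>G\<^esub> v(\<beta>pn\<^sup>-\<^sup>1) r(n)\<close>: on the left \<open>n\<close> moves a
  unique point of \<open>\<Omega>e\<close> to \<open>\<beta>p\<close>, on the right \<open>mn = p\<close> determines \<open>m\<close>.
\<close>

lemma coord_ract:
  fixes v :: "'a \<Rightarrow> 'k::field"
  assumes v: "v \<in> carrier Omega_e" and r: "r \<in> carrier (monoid_algebra G)"
  shows "coord \<beta> (v \<bullet>\<^bsub>transf_module M\<^esub> r) = coord \<beta> v \<otimes>\<^bsub>monoid_algebra G\<^esub> r"
proof
  fix p
  let ?c = "of_nat (card (carrier G)) :: 'k"
  have coord: "coord \<beta> v \<in> carrier (monoid_algebra G)"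
    by (simp add: coord_def carrier_monoid_algebra)
  show "coord \<beta> (v \<bullet>\<^bsub>transf_module M\<^esub> r) p = (coord \<beta> v \<otimes>\<^bsub>monoid_algebra G\<^esub> r) p"
  proof (cases "p \<in> carrier G")
    case False
    then show ?thesis
      using finite_monoid.mult_alg_closed[OF finite_monoid_local_group coord r]
      by (simp add: coord_def carrier_monoid_algebra)
  next
    case p: True
    have "(v \<bullet>\<^bsub>transf_module M\<^esub> r) (p \<beta>) =
        (\<Sum>\<alpha>\<in>UNIV. \<Sum>n\<in>carrier G. if n \<alpha> = p \<beta> then v \<alpha> * r n else 0)"
      unfolding transf_module_simps
      by (intro sum.cong[OF refl] sum.mono_neutral_right)
        (use r G_mem(1) in \<open>auto simp: carrier_monoid_algebra intro: finite_subset[OF subset_UNIV]\<close>)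
    also have "\<dots> = (\<Sum>n\<in>carrier G. \<Sum>\<alpha>\<in>UNIV. if n \<alpha> = p \<beta> then v \<alpha> * r n else 0)"
      by (rule sum.swap)
    also have "\<dots> = (\<Sum>n\<in>carrier G. v ((inv\<^bsub>G\<^esub> n) (p \<beta>)) * r n)"
    proof (rule sum.cong[OF refl])
      fix n assume n: "n \<in> carrier G"
      have "(if n \<alpha> = p \<beta> then v \<alpha> * r n else 0) =
          (if \<alpha> = (inv\<^bsub>G\<^esub> n) (p \<beta>) then v \<alpha> * r n else 0)" for \<alpha>
      proof (cases "e \<alpha> = \<alpha>")
        case True
        then have "n \<alpha> = p \<beta> \<longleftrightarrow> \<alpha> = (inv\<^bsub>G\<^esub> n) (p \<beta>)"
          using G_inv[OF n] G_mem(3)[OF p] by metis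
        then show ?thesis by simp
      next
        case False
        then have "v \<alpha> = 0"
          using v by (simp add: carrier_times_idem_transf)
        then show ?thesis
          unfolding \<open>v \<alpha> = 0\<close> by simp
      qed
      then show "(\<Sum>\<alpha>\<in>UNIV. if n \<alpha> = p \<beta> then v \<alpha> * r n else 0) =
          v ((inv\<^bsub>G\<^esub> n) (p \<beta>)) * r n"
        by simp
    qed
    finally have lhs: "coord \<beta> (v \<bullet>\<^bsub>transf_module M\<^esub> r) p =
        (\<Sum>n\<in>carrier G. v ((inv\<^bsub>G\<^esub> n) (p \<beta>)) * r n) / ?c"
      using p by (simp add: coord_def)
    have "(coord \<beta> v \<otimes>\<^bsub>monoid_algebra G\<^esub> r) p =
        (\<Sum>n\<in>carrier G. \<Sum>m\<in>carrier G. if m \<otimes>\<^bsub>G\<^esub> n = p then coord \<beta> v m * r n else 0)"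
      unfolding mult_monoid_algebra by (rule sum.swap)
    also have "\<dots> = (\<Sum>n\<in>carrier G. v ((inv\<^bsub>G\<^esub> n) (p \<beta>)) * r n / ?c)"
    proof (rule sum.cong[OF refl])
      fix n assume n: "n \<in> carrier G"
      have "m \<otimes>\<^bsub>G\<^esub> n = p \<longleftrightarrow> m = p \<otimes>\<^bsub>G\<^esub> inv\<^bsub>G\<^esub> n" if "m \<in> carrier G" for m
        using that n p by (metis G.inv_solve_right)
      then have "(\<Sum>m\<in>carrier G. if m \<otimes>\<^bsub>G\<^esub> n = p then coord \<beta> v m * r n else 0) =
          (\<Sum>m\<in>carrier G. if m = p \<otimes>\<^bsub>G\<^esub> inv\<^bsub>G\<^esub> n then coord \<beta> v m * r n else 0)"
        by (intro sum.cong) auto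
      also have "\<dots> = coord \<beta> v (p \<otimes>\<^bsub>G\<^esub> inv\<^bsub>G\<^esub> n) * r n"
        using n p finite_G by simp
      also have "\<dots> = v ((inv\<^bsub>G\<^esub> n) (p \<beta>)) * r n / ?c"
        using G.m_closed[OF p G.inv_closed[OF n]] by (simp add: coord_def G_simps)
      finally show "(\<Sum>m\<in>carrier G. if m \<otimes>\<^bsub>G\<^esub> n = p then coord \<beta> v m * r n else 0) =
          v ((inv\<^bsub>G\<^esub> n) (p \<beta>)) * r n / ?c" .
    qed
    finally show ?thesis
      unfolding lhs by (simp add: sum_divide_distrib)
  qed
qed

lemma basis_ract_coord:
  fixes v :: "'a \<Rightarrow> 'k::field"
  shows "(basis_elt \<beta> \<bullet>\<^bsub>transf_module M\<^esub> coord \<beta> v) \<gamma> =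
    (\<Sum>m\<in>carrier G. if m \<beta> = \<gamma> then v \<gamma> / of_nat (card (carrier G)) else 0)"
proof -
  have "(basis_elt \<beta> \<bullet>\<^bsub>transf_module M\<^esub> coord \<beta> v) \<gamma> =
      (\<Sum>\<alpha>\<in>UNIV. if \<alpha> = \<beta> then \<Sum>m\<in>M. if m \<beta> = \<gamma> then coord \<beta> v m else 0 else 0)"
    unfolding transf_module_simps
    by (intro sum.cong[OF refl]) (auto simp: basis_elt_def intro!: sum.cong sum.neutral)
  also have "\<dots> = (\<Sum>m\<in>M. if m \<beta> = \<gamma> then coord \<beta> v m else 0)"
    by simp
  also have "\<dots> = (\<Sum>m\<in>carrier G. if m \<beta> = \<gamma> then coord \<beta> v m else 0)"
    by (rule sum.mono_neutral_right)
      (use G_mem(1) in \<open>auto simp: coord_def intro: finite_subset[OF subset_UNIV]\<close>)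
  also have "\<dots> = (\<Sum>m\<in>carrier G. if m \<beta> = \<gamma> then v \<gamma> / of_nat (card (carrier G)) else 0)"
    by (rule sum.cong) (auto simp: coord_def)
  finally show ?thesis .
qed

text \<open>
  The fixed points \<open>\<beta>\<close> of \<open>e\<close> with the averaged coordinates form a dual basis: for a fixed point
  \<open>\<gamma>\<close> and each \<open>m \<in> G\<close> exactly one \<open>\<beta>\<close> has \<open>\<beta>m = \<gamma>\<close>, so the coefficient at \<open>\<gamma>\<close> is the sum of
  \<open>|G|\<close> copies of \<open>v(\<gamma>)/|G|\<close>. Dividing by \<open>|G|\<close> requires it to be nonzero in the field.
\<close>

lemma projective_Ind_transf:
  "projective_rmodule TYPE('b) TYPE('c) (monoid_algebra (transf_monoid M))
    (Ind (transf_monoid M) e (times_idem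
      (transf_module M :: (('a \<Rightarrow> 'a) \<Rightarrow> 'k::field_char_0, 'a \<Rightarrow> 'k) rmodule) e))"
proof -
  let ?U = "transf_module M :: (('a \<Rightarrow> 'a) \<Rightarrow> 'k, 'a \<Rightarrow> 'k) rmodule"
  let ?Ue = "times_idem ?U e" and ?I = "{\<beta>. e \<beta> = \<beta>}"
  interpret U: local_module "transf_monoid M" e ?U by (rule local_module_transf)
  show ?thesis
    unfolding U.Ind_eq
  proof (rule U.projective_Ind_dual_basis)
    show "finite ?I" by simp
    show basis: "basis_elt \<beta> \<in> carrier ?Ue" if "\<beta> \<in> ?I" for \<beta>
      using that by (auto simp: carrier_times_idem_transf basis_elt_def)
    show c: "coord \<beta> \<in> rmodule_hom (monoid_algebra G) ?Ue (regular_rmodule (monoid_algebra G))" for \<beta>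
    proof -
      have "coord \<beta> v \<in> carrier (monoid_algebra G)" for v :: "'a \<Rightarrow> 'k"
        by (simp add: coord_def carrier_monoid_algebra)
      moreover have "coord \<beta> (\<lambda>\<alpha>. v \<alpha> + w \<alpha>) = (\<lambda>m. coord \<beta> v m + coord \<beta> w m)"
        for v w :: "'a \<Rightarrow> 'k"
        by (auto simp: coord_def add_divide_distrib)
      ultimately show ?thesis
        by (auto simp: rmodule_hom_def hom_def regular_rmodule_simps U.times_idem_simps
            add_monoid_algebra transf_module_simps(2) coord_ract)
    qed
    fix v assume v: "v \<in> carrier ?Ue"
    let ?c = "of_nat (card (carrier G)) :: 'k"
    have "(\<Oplus>\<^bsub>?Ue\<^esub>\<beta>\<in>?I. basis_elt \<beta> \<bullet>\<^bsub>?U\<^esub> coord \<beta> v) =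
        (\<lambda>\<gamma>. \<Sum>\<beta>\<in>?I. (basis_elt \<beta> \<bullet>\<^bsub>?U\<^esub> coord \<beta> v) \<gamma>)"
    proof (rule finsum_pointwise[OF U.abelian_group_times_idem])
      have "coord \<beta> v \<in> carrier (monoid_algebra G)" for \<beta>
        by (simp add: coord_def carrier_monoid_algebra)
      from U.V.ract_closed[OF basis this, unfolded U.times_idem_simps]
      show "(\<lambda>\<beta>. basis_elt \<beta> \<bullet>\<^bsub>?U\<^esub> coord \<beta> v) \<in> ?I \<rightarrow> carrier ?Ue"
        by (rule Pi_I)
    qed (simp_all add: U.times_idem_simps transf_module_simps)
    also have "\<dots> = v"
    proof
      fix \<gamma>
      show "(\<Sum>\<beta>\<in>?I. (basis_elt \<beta> \<bullet>\<^bsub>?U\<^esub> coord \<beta> v) \<gamma>) = v \<gamma>"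
      proof (cases "e \<gamma> = \<gamma>")
        case False
        then have "v \<gamma> = 0"
          using v by (simp add: carrier_times_idem_transf)
        then show ?thesis
          by (auto simp: basis_ract_coord intro!: sum.neutral)
      next
        case True
        have "(\<Sum>\<beta>\<in>?I. (basis_elt \<beta> \<bullet>\<^bsub>?U\<^esub> coord \<beta> v) \<gamma>) =
            (\<Sum>m\<in>carrier G. \<Sum>\<beta>\<in>?I. if m \<beta> = \<gamma> then v \<gamma> / ?c else 0)"
          unfolding basis_ract_coord by (rule sum.swap)
        also have "\<dots> = (\<Sum>m\<in>carrier G. v \<gamma> / ?c)"
        proof (rule sum.cong[OF refl])
          fix m assume m: "m \<in> carrier G"
          have "m \<beta> = \<gamma> \<longleftrightarrow> \<beta> = (inv\<^bsub>G\<^esub> m) \<gamma>" if "\<beta> \<in> ?I" for \<beta>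
            using that True G_inv(1)[OF m, of \<beta>] G_inv(2)[OF m, of \<gamma>] by auto
          then have "(\<Sum>\<beta>\<in>?I. if m \<beta> = \<gamma> then v \<gamma> / ?c else 0) =
              (\<Sum>\<beta>\<in>?I. if \<beta> = (inv\<^bsub>G\<^esub> m) \<gamma> then v \<gamma> / ?c else 0)"
            by (intro sum.cong) auto
          also have "\<dots> = v \<gamma> / ?c"
            using G_mem(3)[OF G.inv_closed[OF m], of \<gamma>] by simp
          finally show "(\<Sum>\<beta>\<in>?I. if m \<beta> = \<gamma> then v \<gamma> / ?c else 0) = v \<gamma> / ?c" .
        qed
        also have "\<dots> = v \<gamma>"
          using finite_G G.one_closed by (auto simp: card_eq_0_iff)
        finally show ?thesis .
      qed
    qed
    finally show "v = (\<Oplus>\<^bsub>?Ue\<^esub>\<beta>\<in>?I. basis_elt \<beta> \<bullet>\<^bsub>?U\<^esub> coord \<beta> v)" by simp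
  qed
qed

text \<open>
  The multiple \<open>k\<cdot>\<gamma>\<close> of the point \<open>\<gamma> = (\<alpha>e)m\<close> is the image of \<open>k\<cdot>\<alpha>e \<otimes> em\<close>. The scalar is put
  into the left factor because the image is known only to be an additive subgroup.
\<close>

lemma natural_surj:
  assumes gen: "{m (e \<alpha>) |\<alpha> m. m \<in> M} = UNIV"
  shows "Ind_natural (transf_module M) ` carrier (Ind (transf_monoid M) e Omega_e) =
    (UNIV :: ('a \<Rightarrow> 'k::field) set)"
proof -
  let ?U = "transf_module M :: (('a \<Rightarrow> 'a) \<Rightarrow> 'k, 'a \<Rightarrow> 'k) rmodule"
  interpret U: local_module "transf_monoid M" e ?U by (rule local_module_transf)
  let ?T = "tensor (monoid_algebra G) (times_idem ?U e) (idem_bimodule (transf_monoid M) e)"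
  let ?Im = "Ind_natural ?U ` carrier ?T"
  have sub: "additive_subgroup ?Im ?U"
    by (rule additive_subgroup_image[OF U.abelian_group_tensor _ U.natural_hom])
      (rule U.U.V.abelian_group_axioms)
  interpret Im: additive_subgroup ?Im ?U by (rule sub)
  (* Scalar multiples of points suffice, by induction over the support. *)
  have single: "(\<lambda>\<beta>. if \<beta> = \<gamma> then k else 0) \<in> ?Im" for \<gamma> and k :: 'k
  proof -
    from gen obtain m \<alpha> where m: "m \<in> M" "\<gamma> = m (e \<alpha>)" by blast
    let ?v = "\<lambda>\<beta>. if \<beta> = e \<alpha> then k else 0"
    let ?a = "basis_elt e \<otimes>\<^bsub>monoid_algebra (transf_monoid M)\<^esub> basis_elt m :: ('a \<Rightarrow> 'a) \<Rightarrow> 'k"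
    have a_eq: "?a = basis_elt (m \<circ> e)"
      using m e_mem by (simp add: basis_elt_mult transf_monoid_simps)
    have v: "?v \<in> carrier (times_idem ?U e)"
      using e_e by (auto simp: carrier_times_idem_transf)
    have a: "?a \<in> carrier (idem_bimodule (transf_monoid M) e)"
      using m(1) by (auto simp: idem_bimodule_def Let_def basis_elt_alg transf_monoid_simps)
    have "Ind_natural ?U (pure_tensor (monoid_algebra G) (times_idem ?U e)
        (idem_bimodule (transf_monoid M) e) ?v ?a) = ?v \<bullet>\<^bsub>?U\<^esub> ?a"
      by (rule U.natural_pure[OF v a])
    also have "\<dots> = (\<lambda>\<beta>. if \<beta> = \<gamma> then k else 0)"
    proof
      fix \<beta>
      have "(?v \<bullet>\<^bsub>?U\<^esub> ?a) \<beta> =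
          (\<Sum>\<alpha>'\<in>UNIV. if \<alpha>' = e \<alpha> then (if \<gamma> = \<beta> then k else 0) else 0)"
        unfolding a_eq ract_transf_basis[OF comp_in[OF e_mem m(1)]]
        by (intro sum.cong) (auto simp: m(2) e_e)
      then show "(?v \<bullet>\<^bsub>?U\<^esub> ?a) \<beta> = (if \<beta> = \<gamma> then k else 0)" by auto
    qed
    finally show ?thesis
      using U.pure_closed[OF v a] by (metis (no_types, lifting) imageI)
  qed
  have "(\<lambda>\<beta>. if \<beta> \<in> A then w \<beta> else 0) \<in> ?Im" if "finite A" for A and w :: "'a \<Rightarrow> 'k"
    using that
  proof (induction A)
    case empty
    then show ?case
      using Im.zero_closed by (simp add: transf_module_simps)
  next
    case (insert \<gamma> A)
    have "(\<lambda>\<beta>. if \<beta> \<in> insert \<gamma> A then w \<beta> else 0) =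
        (\<lambda>\<beta>. if \<beta> = \<gamma> then w \<gamma> else 0) \<oplus>\<^bsub>?U\<^esub> (\<lambda>\<beta>. if \<beta> \<in> A then w \<beta> else 0)"
      using insert.hyps by (auto simp: transf_module_simps)
    then show ?case
      using Im.a_closed[OF single insert.IH] by simp
  qed
  from this[of UNIV] have "w \<in> ?Im" for w
    by simp
  then show ?thesis
    unfolding U.Ind_eq by blast
qed

end

section \<open>The projective cover\<close>

theorem theorem9p7:
  fixes M :: "('a::finite \<Rightarrow> 'a) set" and e :: "'a \<Rightarrow> 'a"
  assumes "submonoid M full_transf"
    and "e \<in> idempotents (transf_monoid M) (minimal_ideal (transf_monoid M))"
  shows "(transitive_transf M \<longrightarrow> {m (e \<alpha>) |\<alpha> m. m \<in> M} = UNIV) \<and>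
    ({m (e \<alpha>) |\<alpha> m. m \<in> M} = UNIV \<longrightarrow>
      (let KM = monoid_algebra (transf_monoid M) :: (('a \<Rightarrow> 'a) \<Rightarrow> 'k::field_char_0) ring;
           K\<Omega> = transf_module M :: (('a \<Rightarrow> 'a) \<Rightarrow> 'k, 'a \<Rightarrow> 'k) rmodule;
           K\<Omega>e = times_idem K\<Omega> e;
           eKM = idem_bimodule (transf_monoid M) e :: (('a \<Rightarrow> 'a) \<Rightarrow> 'k, _, _) bimodule;
           \<phi> = Ind_natural K\<Omega>
       in (\<forall>v\<in>carrier K\<Omega>e. \<forall>a\<in>carrier eKM.
             \<phi> (Ind_tensor (transf_monoid M) e K\<Omega>e v a) = v \<bullet>\<^bsub>K\<Omega>\<^esub> a) \<and>
          projective_cover TYPE('b) TYPE('c) KM (Ind (transf_monoid M) e K\<Omega>e) K\<Omega> \<phi>))"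
proof (intro conjI impI)
  assume "transitive_transf M"
  then show "{m (e \<alpha>) |\<alpha> m. m \<in> M} = UNIV"
    unfolding transitive_transf_def by blast
next
  assume gen: "{m (e \<alpha>) |\<alpha> m. m \<in> M} = UNIV"
  interpret transf_idempotent M e
    using assms by (simp add: transf_idempotent_def finite_transf_monoid_def
        transf_idempotent_axioms_def)
  interpret U: local_module "transf_monoid M" e
      "transf_module M :: (('a \<Rightarrow> 'a) \<Rightarrow> 'k, 'a \<Rightarrow> 'k) rmodule"
    by (rule local_module_transf)
  show "let KM = monoid_algebra (transf_monoid M) :: (('a \<Rightarrow> 'a) \<Rightarrow> 'k) ring;
           K\<Omega> = transf_module M :: (('a \<Rightarrow> 'a) \<Rightarrow> 'k, 'a \<Rightarrow> 'k) rmodule;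
           K\<Omega>e = times_idem K\<Omega> e;
           eKM = idem_bimodule (transf_monoid M) e :: (('a \<Rightarrow> 'a) \<Rightarrow> 'k, _, _) bimodule;
           \<phi> = Ind_natural K\<Omega>
       in (\<forall>v\<in>carrier K\<Omega>e. \<forall>a\<in>carrier eKM.
             \<phi> (Ind_tensor (transf_monoid M) e K\<Omega>e v a) = v \<bullet>\<^bsub>K\<Omega>\<^esub> a) \<and>
          projective_cover TYPE('b) TYPE('c) KM (Ind (transf_monoid M) e K\<Omega>e) K\<Omega> \<phi>"
    unfolding Let_def projective_cover_def
  proof (intro conjI ballI)
    show "Ind_natural (transf_module M) \<in> rmodule_epi (monoid_algebra (transf_monoid M))
        (Ind (transf_monoid M) e Omega_e)
        (transf_module M :: (('a \<Rightarrow> 'a) \<Rightarrow> 'k, 'a \<Rightarrow> 'k) rmodule)"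
      using U.natural_rmodule_hom natural_surj[where 'k = 'k, OF gen]
      by (simp add: rmodule_epi_def U.Ind_eq transf_module_simps)
    show "projective_rmodule TYPE('b) TYPE('c) (monoid_algebra (transf_monoid M))
        (Ind (transf_monoid M) e
          (times_idem (transf_module M :: (('a \<Rightarrow> 'a) \<Rightarrow> 'k, 'a \<Rightarrow> 'k) rmodule) e))"
      by (rule projective_Ind_transf)
  qed (simp_all add: U.Ind_tensor_eq U.natural_pure right_module_transf
      U.Ind_eq U.kernel_natural_rad[OF sandwich_in_local_group])
qed

end
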